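(* Suppose there is $\varepsilon>0$ such that the LCS with $k$ Mismatches problem can be solved in $O(n^{2-\varepsilon})$ time on strings over a binary alphabet for $k=\Omega(\log n)$. Then SETH is false.
   Context: LCS with $k$ Mismatches: given two strings $T_1,T_2$ of length $n$ and an integer $k$, find a maximum-length substring of $T_1$ that occurs in $T_2$ with at most $k$ mismatches, i.e.\ substrings $S_1$ of $T_1$ and $S_2$ of $T_2$ of equal maximum length whose Hamming distance (number of mismatching positions) is at most $k$. SETH (Strong Exponential Time Hypothesis): for every $\delta>0$ there exists an integer $q$ such that SAT on $q$-CNF formulas with $m$ clauses and $n$ variables cannot be solved in $m^{O(1)}2^{(1-\delta)n}$ time. *)

theory Defs
  imports Complex_Main "HOL-Library.Landau_Symbols" "HOL-Library.Sublist"
begin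

unbundle bit_operations_syntax

text \<open>
  The model of computation is the unit-cost word RAM with word length \<open>w\<close>: a program has
  finitely many registers (named by numbers) and a memory addressed by words, and all arithmetic
  is modulo \<open>2 ^ w\<close>.  Control flow is structured instead of given by jumps; this changes
  running times by constant factors only.
\<close>

datatype binop = Plus | Minus | Times | Div | Mod | BAnd | BOr | BXor | Shl | Shr | Less | Equal

fun eval_binop :: "nat \<Rightarrow> binop \<Rightarrow> nat \<Rightarrow> nat \<Rightarrow> nat" where
  "eval_binop w Plus x y = (x + y) mod 2 ^ w"
| "eval_binop w Minus x y = nat ((int x - int y) mod 2 ^ w)"
| "eval_binop w Times x y = (x * y) mod 2 ^ w"
| "eval_binop w Div x y = x div y"
| "eval_binop w Mod x y = x mod y"
| "eval_binop w BAnd x y = x AND y"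
| "eval_binop w BOr x y = x OR y"
| "eval_binop w BXor x y = x XOR y"
| "eval_binop w Shl x y = push_bit y x mod 2 ^ w"
| "eval_binop w Shr x y = drop_bit y x"
| "eval_binop w Less x y = of_bool (x < y) mod 2 ^ w"
| "eval_binop w Equal x y = of_bool (x = y) mod 2 ^ w"

datatype com =
    Skip
  | Const nat nat            \<comment> \<open>\<open>Const r v\<close>: \<open>r := v\<close>\<close>
  | Op nat binop nat nat     \<comment> \<open>\<open>Op r f a b\<close>: \<open>r := f a b\<close>\<close>
  | Load nat nat             \<comment> \<open>\<open>Load r a\<close>: \<open>r := M[a]\<close>\<close>
  | Store nat nat            \<comment> \<open>\<open>Store a r\<close>: \<open>M[a] := r\<close>\<close>
  | Seq com com
  | IfNz nat com com
  | WhileNz nat com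

type_synonym state = "(nat \<Rightarrow> nat) \<times> (nat \<Rightarrow> nat)"   \<comment> \<open>registers, memory\<close>

text \<open>\<open>exec w c s t s'\<close>: with word length \<open>w\<close>, command \<open>c\<close> started in state \<open>s\<close> halts in state
  \<open>s'\<close> after exactly \<open>t\<close> steps.\<close>

inductive exec :: "nat \<Rightarrow> com \<Rightarrow> state \<Rightarrow> nat \<Rightarrow> state \<Rightarrow> bool" for w :: nat where
  Skip: "exec w Skip s 1 s"
| Const: "exec w (Const r v) (R, M) 1 (R(r := v mod 2 ^ w), M)"
| Op: "exec w (Op r f a b) (R, M) 1 (R(r := eval_binop w f (R a) (R b)), M)"
| Load: "exec w (Load r a) (R, M) 1 (R(r := M (R a)), M)"
| Store: "exec w (Store a r) (R, M) 1 (R, M(R a := R r))"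
| Seq: "exec w c1 s t1 s' \<Longrightarrow> exec w c2 s' t2 s'' \<Longrightarrow> exec w (Seq c1 c2) s (t1 + t2) s''"
| IfTrue: "fst s r \<noteq> 0 \<Longrightarrow> exec w c1 s t s' \<Longrightarrow> exec w (IfNz r c1 c2) s (t + 1) s'"
| IfFalse: "fst s r = 0 \<Longrightarrow> exec w c2 s t s' \<Longrightarrow> exec w (IfNz r c1 c2) s (t + 1) s'"
| WhileFalse: "fst s r = 0 \<Longrightarrow> exec w (WhileNz r c) s 1 s"
| WhileTrue: "fst s r \<noteq> 0 \<Longrightarrow> exec w c s t1 s' \<Longrightarrow> exec w (WhileNz r c) s' t2 s'' \<Longrightarrow>
    exec w (WhileNz r c) s (t1 + t2 + 1) s''"

definition init :: "nat list \<Rightarrow> state" where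
  "init xs = ((\<lambda>_. 0), (\<lambda>i. if i < length xs then xs ! i else 0))"

text \<open>
  \<open>p\<close> solves the problem with instances \<open>I\<close>, input encoding \<open>enc\<close> and specification \<open>spec\<close> (of
  the final register contents) in time \<open>\<tau>\<close>.  As usual on the word RAM, the word length is at least a
  constant (depending on the program) times the logarithm of the input size; it is also
  at least that constant times the logarithm of the running time, so that an algorithm of
  exponential running time can address the memory it uses.  The time bound must not depend on \<open>w\<close>.
\<close>

definition solves_in_time ::
  "com \<Rightarrow> ('i \<Rightarrow> nat list) \<Rightarrow> 'i set \<Rightarrow> ('i \<Rightarrow> (nat \<Rightarrow> nat) \<Rightarrow> bool) \<Rightarrow> ('i \<Rightarrow> real) \<Rightarrow> bool" where
  "solves_in_time p enc I spec \<tau> \<longleftrightarrow>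
    (\<exists>a::nat. \<forall>x\<in>I. \<forall>w::nat.
      (\<forall>v\<in>set (enc x). v < 2 ^ w) \<and> real w \<ge> real a * log 2 (real (length (enc x)) + \<tau> x) \<longrightarrow>
      (\<exists>t R M. exec w p (init (enc x)) t (R, M) \<and> real t \<le> \<tau> x \<and> spec x R))"


definition hamming :: "'a list \<Rightarrow> 'a list \<Rightarrow> nat" where
  "hamming xs ys = card {i. i < length xs \<and> xs ! i \<noteq> ys ! i}"

definition common_k :: "nat \<Rightarrow> 'a list \<Rightarrow> 'a list \<Rightarrow> 'a list \<Rightarrow> 'a list \<Rightarrow> bool" where
  "common_k k T1 T2 S1 S2 \<longleftrightarrow>
    sublist S1 T1 \<and> sublist S2 T2 \<and> length S1 = length S2 \<and> hamming S1 S2 \<le> k"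

definition longest_common_k :: "nat \<Rightarrow> 'a list \<Rightarrow> 'a list \<Rightarrow> 'a list \<Rightarrow> 'a list \<Rightarrow> bool" where
  "longest_common_k k T1 T2 S1 S2 \<longleftrightarrow>
    common_k k T1 T2 S1 S2 \<and>
    (\<forall>S1' S2'. common_k k T1 T2 S1' S2' \<longrightarrow> length S1' \<le> length S1)"

type_synonym lcs_instance = "bool list \<times> bool list \<times> nat"

text \<open>The restriction \<open>k = \<Omega>(log n)\<close>: both \<open>k\<close> and the strings are part of the input, and \<open>k\<close> is
  at least a fixed multiple \<open>C\<close> of \<open>log n\<close>.\<close>

definition lcs_instances :: "real \<Rightarrow> lcs_instance set" where
  "lcs_instances C =
    {(T1, T2, k). length T1 = length T2 \<and> real k \<ge> C * log 2 (real (length T1))}"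

definition enc_lcs :: "lcs_instance \<Rightarrow> nat list" where
  "enc_lcs = (\<lambda>(T1, T2, k). [length T1, k] @ map of_bool T1 @ map of_bool T2)"

text \<open>Registers 0, 1, 2 hold the length of the substrings and their starting positions.\<close>

definition lcs_spec :: "lcs_instance \<Rightarrow> (nat \<Rightarrow> nat) \<Rightarrow> bool" where
  "lcs_spec = (\<lambda>(T1, T2, k) R. R 1 + R 0 \<le> length T1 \<and> R 2 + R 0 \<le> length T2 \<and>
    longest_common_k k T1 T2 (take (R 0) (drop (R 1) T1)) (take (R 0) (drop (R 2) T2)))"


text \<open>Clauses of a \<open>q\<close>-CNF formula have at most \<open>q\<close> literals.  A CNF formula is given by its number \<open>n\<close> of variables (which are \<open>0, \<dots>, n - 1\<close>) and the
  list of its clauses; the literal \<open>(v, b)\<close> is true if \<open>v\<close> has value \<open>b\<close>.\<close>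

type_synonym cnf = "nat \<times> (nat \<times> bool) list list"

definition q_cnf :: "nat \<Rightarrow> cnf set" where
  "q_cnf q = {(n, F). \<forall>C\<in>set F. length C \<le> q \<and> (\<forall>(v, b)\<in>set C. v < n)}"

definition satisfiable :: "cnf \<Rightarrow> bool" where
  "satisfiable = (\<lambda>(n, F). \<exists>\<alpha> :: nat \<Rightarrow> bool. \<forall>C\<in>set F. \<exists>(v, b)\<in>set C. \<alpha> v = b)"

definition enc_cnf :: "cnf \<Rightarrow> nat list" where
  "enc_cnf = (\<lambda>(n, F). [n, length F] @
     concat (map (\<lambda>C. length C # map (\<lambda>(v, b). 2 * v + of_bool b) C) F))"

definition sat_spec :: "cnf \<Rightarrow> (nat \<Rightarrow> nat) \<Rightarrow> bool" where
  "sat_spec \<phi> R \<longleftrightarrow> (R 0 \<noteq> 0 \<longleftrightarrow> satisfiable \<phi>)"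

text \<open>The bound \<open>m^O(1) * 2^((1 - \<delta>) n)\<close> is \<open>f m * 2 powr ((1 - \<delta>) * n)\<close> with a polynomially bounded \<open>f\<close>;
  the algorithm may depend on \<open>q\<close>.\<close>

definition SETH :: bool where
  "SETH \<longleftrightarrow> (\<forall>\<delta>::real. \<delta> > 0 \<longrightarrow> (\<exists>q. \<not> (\<exists>p (f :: nat \<Rightarrow> nat) c :: nat.
     (\<lambda>m. real (f m)) \<in> O(\<lambda>m. real m ^ c) \<and>
     solves_in_time p enc_cnf (q_cnf q) sat_spec
       (\<lambda>(n, F). real (f (length F)) * 2 powr ((1 - \<delta>) * real n)))))"

end

theory Submission imports Defs "HOL-Real_Asymp.Real_Asymp" begin

text \<open>
  Split the variables into two halves with at most \<open>h = \<lceil>n/2\<rceil>\<close> variables. An assignment of one half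
  gives a 0/1 vector with an entry per clause, which is 1 if the clause is not satisfied by this half.
  The formula is satisfiable iff there are orthogonal vectors from the two families. The vectors
  of a family are written into one text, separated by marker zones. Since the marks form a Sidon
  set, a common window of three zones with at most \<open>d\<close> mismatches has to be aligned, and it then contains
  a vector of each family; as every coordinate causes one mismatch, and three if both entries are 1, the
  vectors are orthogonal. Hence the formula is satisfiable iff the LCS with \<open>d\<close> mismatches has at least
  three zones. The texts have length \<open>poly(m, n) * 2 ^ h\<close>, so that an exponent \<open>2 - e\<close> for the LCS becomes
  \<open>(1 - e/2) * n\<close>, and a factor \<open>2 powr (e/4 * n)\<close> absorbs the polynomial in \<open>n\<close>. The clauses need not be sparse,
  because \<open>poly(m)\<close> is allowed in the running time.
\<close>

section \<open>Programming the word RAM\<close>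

text \<open>The assumed LCS program is a black box that may only be started with zero registers and
  a memory holding exactly its own input. The formula, however, occupies the low addresses and is
  reread for every bit of the texts. Hence the texts are built in a buffer beyond their final place,
  then moved down, and the buffer is cleared.

  Three zones are the critical length because the texts have a period of two zones: a window of
  three zones contains a complete marker zone and a complete vector zone whatever its phase, while a
  vector with the two marker zones around it is exactly that long. The codes of two coordinates
  never agree completely, so an aligned window already spends its whole budget \<open>d\<close> on
  one mismatch per coordinate, and nothing is left for a pair of ones.

  The restriction on \<open>k\<close> forces \<open>d\<close> to be at least \<open>C\<close> times
  the logarithm of the text length. As that logarithm grows linearly in \<open>m + n\<close>, a
  constant multiple \<open>K\<close> of \<open>m + n + 1\<close> is enough for \<open>d\<close>. The
  zones are cubic in \<open>d\<close>, which costs polynomial factors only, so a Sidon set of modest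
  density does the job.\<close>

datatype expr = Num nat | Reg nat | Bin binop expr expr | Mem expr

primrec vars :: "expr \<Rightarrow> nat set" where
  "vars (Num v) = {}"
| "vars (Reg r) = {r}"
| "vars (Bin f e1 e2) = vars e1 \<union> vars e2"
| "vars (Mem e) = vars e"

primrec val :: "nat \<Rightarrow> (nat \<Rightarrow> nat) \<Rightarrow> (nat \<Rightarrow> nat) \<Rightarrow> expr \<Rightarrow> nat" where
  "val w R M (Num v) = v mod 2 ^ w"
| "val w R M (Reg r) = R r"
| "val w R M (Bin f e1 e2) = eval_binop w f (val w R M e1) (val w R M e2)"
| "val w R M (Mem e) = M (val w R M e)"

primrec cost :: "expr \<Rightarrow> nat" where
  "cost (Num v) = 1"
| "cost (Reg r) = 1"
| "cost (Bin f e1 e2) = cost e1 + cost e2 + 1"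
| "cost (Mem e) = cost e + 1"

text \<open>The result goes to register \<open>t\<close>; registers above \<open>t\<close> serve as a stack.\<close>

primrec compile :: "nat \<Rightarrow> expr \<Rightarrow> com" where
  "compile t (Num v) = Const t v"
| "compile t (Reg r) = Op t BOr r r"
| "compile t (Bin f e1 e2) = Seq (compile t e1) (Seq (compile (Suc t) e2) (Op t f t (Suc t)))"
| "compile t (Mem e) = Seq (compile t e) (Load t t)"

lemma val_cong: "(\<And>r. r \<in> vars e \<Longrightarrow> R r = R' r) \<Longrightarrow> val w R M e = val w R' M e"
  by (induction e) auto

lemma exec_compile:
  assumes "\<forall>r\<in>vars e. r < t"
  shows "\<exists>R'. exec w (compile t e) (R, M) (cost e) (R', M) \<and> R' t = val w R M e \<and> (\<forall>r<t. R' r = R r)"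
  using assms
proof (induction e arbitrary: t R)
  case (Num v)
  show ?case using exec.Const[of w t v R M] by fastforce
next
  case (Reg r)
  show ?case using exec.Op[of w t BOr r r R M] by fastforce
next
  case (Bin f e1 e2)
  from Bin.IH(1)[of t R] Bin.prems obtain R1 where
    1: "exec w (compile t e1) (R, M) (cost e1) (R1, M)" "R1 t = val w R M e1" "\<forall>r<t. R1 r = R r"
    by auto
  have "\<forall>r\<in>vars e2. r < Suc t" using Bin.prems by (auto intro: less_SucI)
  from Bin.IH(2)[OF this, of R1] obtain R2 where
    2: "exec w (compile (Suc t) e2) (R1, M) (cost e2) (R2, M)" "R2 (Suc t) = val w R1 M e2"
       "\<forall>r<Suc t. R2 r = R1 r"
    by auto
  have "val w R1 M e2 = val w R M e2"
    using Bin.prems 1(3) by (intro val_cong) auto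
  moreover have "exec w (compile t (Bin f e1 e2)) (R, M) (cost e1 + (cost e2 + 1))
      (R2(t := eval_binop w f (R2 t) (R2 (Suc t))), M)"
    using exec.Seq[OF 1(1) exec.Seq[OF 2(1) exec.Op]] by simp
  moreover have "eval_binop w f (R2 t) (R2 (Suc t)) = val w R M (Bin f e1 e2)"
    using 1 2 calculation(1) by simp
  moreover have "\<forall>r<t. (R2(t := eval_binop w f (R2 t) (R2 (Suc t)))) r = R r"
    using 1 2 by simp
  ultimately show ?case by (metis add.assoc cost.simps(3) fun_upd_same)
next
  case (Mem e)
  from Mem.IH[of t R] Mem.prems obtain R1 where
    1: "exec w (compile t e) (R, M) (cost e) (R1, M)" "R1 t = val w R M e" "\<forall>r<t. R1 r = R r"
    by auto
  have "exec w (compile t (Mem e)) (R, M) (cost e + 1) (R1(t := M (R1 t)), M)"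
    using exec.Seq[OF 1(1) exec.Load] by simp
  moreover have "M (R1 t) = val w R M (Mem e)" "\<forall>r<t. (R1(t := M (R1 t))) r = R r"
    using 1 by auto
  ultimately show ?case by (metis cost.simps(4) fun_upd_same)
qed

text \<open>\<open>BOr\<close> of a register with itself serves as the move instruction. It involves
  no reduction modulo \<open>2 ^ w\<close>, so no bound on the register contents is
  required.\<close>

definition assign :: "nat \<Rightarrow> expr \<Rightarrow> com" where
  "assign r e = Seq (compile 32 e) (Op r BOr 32 32)"

definition store :: "expr \<Rightarrow> expr \<Rightarrow> com" where
  "store e1 e2 = Seq (compile 32 e1) (Seq (compile 33 e2) (Store 32 33))"

text \<open>Registers below 32 are program variables, the others are the stack of \<open>compile\<close>.
  The argument \<open>t\<close> is a ghost clock: the postcondition sees it advanced by the running time.\<close>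

definition runs ::
  "nat \<Rightarrow> com \<Rightarrow> (nat \<Rightarrow> nat) \<Rightarrow> (nat \<Rightarrow> nat) \<Rightarrow> nat \<Rightarrow> ((nat \<Rightarrow> nat) \<Rightarrow> (nat \<Rightarrow> nat) \<Rightarrow> nat \<Rightarrow> bool) \<Rightarrow> bool"
  where "runs w c V M t Q \<longleftrightarrow> (\<forall>R. (\<forall>r<32. R r = V r) \<longrightarrow>
    (\<exists>t' R' V' M'. exec w c (R, M) t' (R', M') \<and> (\<forall>r<32. R' r = V' r) \<and> Q V' M' (t + t')))"

lemma runs_assign:
  assumes "\<forall>r\<in>vars e. r < 32" "r < 32" "Q (V(r := val w V M e)) M (t + (cost e + 1))"
  shows "runs w (assign r e) V M t Q"
  unfolding runs_def
proof (intro allI impI)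
  fix R assume R: "\<forall>r<32. R r = V r"
  from exec_compile[OF assms(1)] obtain R' where
    1: "exec w (compile 32 e) (R, M) (cost e) (R', M)" "R' 32 = val w R M e" "\<forall>r<32. R' r = R r"
    by blast
  have "val w R M e = val w V M e" using R assms(1) by (intro val_cong) auto
  moreover have "exec w (assign r e) (R, M) (cost e + 1) (R'(r := R' 32), M)"
    unfolding assign_def using exec.Seq[OF 1(1) exec.Op[of w r BOr 32 32 R' M]] by simp
  ultimately show "\<exists>t' R' V' M'. exec w (assign r e) (R, M) t' (R', M') \<and> (\<forall>r<32. R' r = V' r) \<and>
      Q V' M' (t + t')"
    using 1 R assms
    by (intro exI[of _ "cost e + 1"] exI[of _ "R'(r := R' 32)"] exI[of _ "V(r := val w V M e)"] exI[of _ M])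
       auto
qed

lemma runs_store:
  assumes "\<forall>r\<in>vars e1 \<union> vars e2. r < 32"
    "Q V (M(val w V M e1 := val w V M e2)) (t + (cost e1 + cost e2 + 1))"
  shows "runs w (store e1 e2) V M t Q"
  unfolding runs_def
proof (intro allI impI)
  fix R assume R: "\<forall>r<32. R r = V r"
  from exec_compile[of e1 32] assms(1) obtain R1 where
    1: "exec w (compile 32 e1) (R, M) (cost e1) (R1, M)" "R1 32 = val w R M e1" "\<forall>r<32. R1 r = R r"
    by blast
  have "\<forall>r\<in>vars e2. r < 33" using assms(1) by (auto intro: less_trans[of _ 32])
  from exec_compile[OF this] obtain R2 where
    2: "exec w (compile 33 e2) (R1, M) (cost e2) (R2, M)" "R2 33 = val w R1 M e2" "\<forall>r<33. R2 r = R1 r"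
    by blast
  have "val w R M e1 = val w V M e1" "val w R1 M e2 = val w V M e2"
    using R assms(1) 1(3) by (intro val_cong; auto)+
  moreover have "exec w (store e1 e2) (R, M) (cost e1 + (cost e2 + 1)) (R2, M(R2 32 := R2 33))"
    unfolding store_def using exec.Seq[OF 1(1) exec.Seq[OF 2(1) exec.Store]] by simp
  ultimately show "\<exists>t' R' V' M'. exec w (store e1 e2) (R, M) t' (R', M') \<and> (\<forall>r<32. R' r = V' r) \<and>
      Q V' M' (t + t')"
    using 1 2 R assms
    by (intro exI[of _ "cost e1 + (cost e2 + 1)"] exI[of _ R2] exI[of _ V] exI[of _ "M(R2 32 := R2 33)"])
       (auto simp: add.assoc)
qed

text \<open>The postcondition of \<open>c1\<close> is the correctness of \<open>c2\<close> itself,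
  so that programs are verified by symbolic execution from left to right, without intermediate
  assertions.\<close>

lemma runs_Seq:
  assumes "runs w c1 V M t (\<lambda>V M t. runs w c2 V M t Q)"
  shows "runs w (Seq c1 c2) V M t Q"
  unfolding runs_def
proof (intro allI impI)
  fix R assume R: "\<forall>r<32. R r = V r"
  with assms obtain t1 R1 V1 M1 where
    1: "exec w c1 (R, M) t1 (R1, M1)" "\<forall>r<32. R1 r = V1 r" "runs w c2 V1 M1 (t + t1) Q"
    unfolding runs_def[of _ c1] by metis
  then obtain t2 R2 V2 M2 where
    2: "exec w c2 (R1, M1) t2 (R2, M2)" "\<forall>r<32. R2 r = V2 r" "Q V2 M2 (t + t1 + t2)"
    unfolding runs_def by metis
  show "\<exists>t' R' V' M'. exec w (Seq c1 c2) (R, M) t' (R', M') \<and> (\<forall>r<32. R' r = V' r) \<and> Q V' M' (t + t')"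
    using exec.Seq[OF 1(1) 2(1)] 2(2,3) by (metis add.assoc)
qed

lemma runs_Skip: "Q V M (t + 1) \<Longrightarrow> runs w Skip V M t Q"
  unfolding runs_def using exec.Skip by blast

lemma runs_If:
  assumes "r < 32" "V r \<noteq> 0 \<Longrightarrow> runs w c1 V M (t + 1) Q" "V r = 0 \<Longrightarrow> runs w c2 V M (t + 1) Q"
  shows "runs w (IfNz r c1 c2) V M t Q"
  unfolding runs_def
proof (intro allI impI)
  fix R assume R: "\<forall>r<32. R r = V r"
  show "\<exists>t' R' V' M'. exec w (IfNz r c1 c2) (R, M) t' (R', M') \<and> (\<forall>r<32. R' r = V' r) \<and> Q V' M' (t + t')"
  proof (cases "V r = 0")
    case True
    then obtain t' R' V' M' where "exec w c2 (R, M) t' (R', M')" "\<forall>r<32. R' r = V' r" "Q V' M' (t + 1 + t')"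
      using assms(3) R unfolding runs_def by blast
    moreover have "fst (R, M) r = 0" using True R assms(1) by simp
    ultimately show ?thesis
      using exec.IfFalse[of "(R, M)" r w c2 t' "(R', M')" c1]
      by (metis add.assoc add.commute)
  next
    case False
    then obtain t' R' V' M' where "exec w c1 (R, M) t' (R', M')" "\<forall>r<32. R' r = V' r" "Q V' M' (t + 1 + t')"
      using assms(2) R unfolding runs_def by blast
    moreover have "fst (R, M) r \<noteq> 0" using False R assms(1) by simp
    ultimately show ?thesis
      using exec.IfTrue[of "(R, M)" r w c1 t' "(R', M')" c2]
      by (metis add.assoc add.commute)
  qed
qed

text \<open>The invariant is indexed by the number of iterations still to come. As this number is
  known at the start, one induction yields termination, correctness and, through the ghost clock,
  the running time. Each test costs one step, whence the \<open>t + 1\<close>.\<close>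

lemma runs_While:
  assumes "r < 32" "I n V M t"
    "\<And>i V M t. I (Suc i) V M t \<Longrightarrow> i < n \<Longrightarrow> V r \<noteq> 0 \<and> runs w c V M (t + 1) (I i)"
    "\<And>V M t. I 0 V M t \<Longrightarrow> V r = 0 \<and> Q V M (t + 1)"
  shows "runs w (WhileNz r c) V M t Q"
  using assms(2,3)
proof (induction n arbitrary: V M t)
  case 0
  then have "V r = 0" "Q V M (t + 1)" using assms(4) by auto
  then show ?case unfolding runs_def
    using exec.WhileFalse[of _ r w c] assms(1) by (metis fst_conv)
next
  case (Suc n)
  have V: "V r \<noteq> 0" "runs w c V M (t + 1) (I n)" using Suc.prems by auto
  show ?case unfolding runs_def
  proof (intro allI impI)
    fix R assume R: "\<forall>r<32. R r = V r"
    with V obtain t1 R1 V1 M1 where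
      1: "exec w c (R, M) t1 (R1, M1)" "\<forall>r<32. R1 r = V1 r" "I n V1 M1 (t + 1 + t1)"
      unfolding runs_def by blast
    have "runs w (WhileNz r c) V1 M1 (t + 1 + t1) Q"
      using Suc.prems(2) by (intro Suc.IH 1(3)) auto
    with 1(2) obtain t2 R2 V2 M2 where
      2: "exec w (WhileNz r c) (R1, M1) t2 (R2, M2)" "\<forall>r<32. R2 r = V2 r" "Q V2 M2 (t + 1 + t1 + t2)"
      unfolding runs_def by blast
    have "exec w (WhileNz r c) (R, M) (t1 + t2 + 1) (R2, M2)"
      using V(1) R assms(1) by (intro exec.WhileTrue[OF _ 1(1) 2(1)]) auto
    moreover have "t + 1 + t1 + t2 = t + (t1 + t2 + 1)" by simp
    ultimately show "\<exists>t' R' V' M'. exec w (WhileNz r c) (R, M) t' (R', M') \<and> (\<forall>r<32. R' r = V' r) \<and>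
        Q V' M' (t + t')"
      using 2(2,3) by metis
  qed
qed

section \<open>Renaming registers\<close>

primrec regs :: "com \<Rightarrow> nat set" where
  "regs Skip = {}"
| "regs (Const r v) = {r}"
| "regs (Op r f a b) = {r, a, b}"
| "regs (Load r a) = {r, a}"
| "regs (Store a r) = {a, r}"
| "regs (Seq c1 c2) = regs c1 \<union> regs c2"
| "regs (IfNz r c1 c2) = {r} \<union> regs c1 \<union> regs c2"
| "regs (WhileNz r c) = {r} \<union> regs c"

primrec rename :: "(nat \<Rightarrow> nat) \<Rightarrow> com \<Rightarrow> com" where
  "rename g Skip = Skip"
| "rename g (Const r v) = Const (g r) v"
| "rename g (Op r f a b) = Op (g r) f (g a) (g b)"
| "rename g (Load r a) = Load (g r) (g a)"
| "rename g (Store a r) = Store (g a) (g r)"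
| "rename g (Seq c1 c2) = Seq (rename g c1) (rename g c2)"
| "rename g (IfNz r c1 c2) = IfNz (g r) (rename g c1) (rename g c2)"
| "rename g (WhileNz r c) = WhileNz (g r) (rename g c)"

lemma finite_regs: "finite (regs c)"
  by (induction c) auto

lemma rename_ident: "rename (\<lambda>r. r) c = c"
  by (induction c) auto

text \<open>This is used in two ways. A shift with \<open>A = UNIV\<close> moves the reduction away
  from the registers of the LCS program. The identity with \<open>A = {..<b}\<close> gives a frame
  rule: a program confined to registers below \<open>b\<close> runs in the same way whatever the
  others contain, and leaves those unchanged.\<close>

lemma exec_rename:
  assumes "exec w c s t s'" "inj g" "regs c \<subseteq> A" "\<forall>r\<in>A. S (g r) = fst s r"
  shows "\<exists>S'. exec w (rename g c) (S, snd s) t (S', snd s') \<and> (\<forall>r\<in>A. S' (g r) = fst s' r) \<and>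
    (\<forall>r. r \<notin> g ` A \<longrightarrow> S' r = S r)"
  using assms
proof (induction arbitrary: S rule: exec.induct)
  case (Skip s)
  then show ?case using exec.Skip[of w "(S, snd s)"] by auto
next
  case (Const r v R M)
  then have "\<forall>x\<in>A. (S(g r := v mod 2 ^ w)) (g x) = (R(r := v mod 2 ^ w)) x"
    "\<forall>x. x \<notin> g ` A \<longrightarrow> (S(g r := v mod 2 ^ w)) x = S x"
    by (auto dest: injD)
  then show ?case using exec.Const[of w "g r" v S M] by (metis fst_conv rename.simps(2) snd_conv)
next
  case (Op r f a b R M)
  then have "S (g a) = R a" "S (g b) = R b" by auto
  then have "exec w (rename g (Op r f a b)) (S, M) 1 (S(g r := eval_binop w f (R a) (R b)), M)"
    using exec.Op[of w "g r" f "g a" "g b" S M] by simp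
  moreover have "\<forall>x\<in>A. (S(g r := eval_binop w f (R a) (R b))) (g x) = (R(r := eval_binop w f (R a) (R b))) x"
    "\<forall>x. x \<notin> g ` A \<longrightarrow> (S(g r := eval_binop w f (R a) (R b))) x = S x"
    using Op by (auto dest: injD)
  ultimately show ?case by (metis fst_conv snd_conv)
next
  case (Load r a R M)
  then have "S (g a) = R a" by auto
  then have "exec w (rename g (Load r a)) (S, M) 1 (S(g r := M (R a)), M)"
    using exec.Load[of w "g r" "g a" S M] by simp
  moreover have "\<forall>x\<in>A. (S(g r := M (R a))) (g x) = (R(r := M (R a))) x"
    "\<forall>x. x \<notin> g ` A \<longrightarrow> (S(g r := M (R a))) x = S x"
    using Load by (auto dest: injD)
  ultimately show ?case by (metis fst_conv snd_conv)
next
  case (Store a r R M)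
  then have "S (g a) = R a" "S (g r) = R r" by auto
  then have "exec w (rename g (Store a r)) (S, M) 1 (S, M(R a := R r))"
    using exec.Store[of w "g a" "g r" S M] by simp
  with Store show ?case by (metis fst_conv snd_conv)
next
  case (Seq c1 s t1 s' c2 t2 s'')
  from Seq.IH(1)[of S] Seq.prems obtain S1 where
    1: "exec w (rename g c1) (S, snd s) t1 (S1, snd s')" "\<forall>r\<in>A. S1 (g r) = fst s' r"
       "\<forall>r. r \<notin> g ` A \<longrightarrow> S1 r = S r" by auto
  from Seq.IH(2)[of S1] Seq.prems 1 obtain S2 where
    2: "exec w (rename g c2) (S1, snd s') t2 (S2, snd s'')" "\<forall>r\<in>A. S2 (g r) = fst s'' r"
       "\<forall>r. r \<notin> g ` A \<longrightarrow> S2 r = S1 r" by auto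
  show ?case using exec.Seq[OF 1(1) 2(1)] 1 2 by auto
next
  case (IfTrue s r c1 t s' c2)
  from IfTrue.IH[of S] IfTrue.prems obtain S1 where
    1: "exec w (rename g c1) (S, snd s) t (S1, snd s')" "\<forall>r\<in>A. S1 (g r) = fst s' r"
       "\<forall>r. r \<notin> g ` A \<longrightarrow> S1 r = S r" by auto
  have "fst (S, snd s) (g r) \<noteq> 0" using IfTrue by auto
  from exec.IfTrue[OF this 1(1), of "rename g c2"] 1 show ?case by auto
next
  case (IfFalse s r c2 t s' c1)
  from IfFalse.IH[of S] IfFalse.prems obtain S1 where
    1: "exec w (rename g c2) (S, snd s) t (S1, snd s')" "\<forall>r\<in>A. S1 (g r) = fst s' r"
       "\<forall>r. r \<notin> g ` A \<longrightarrow> S1 r = S r" by auto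
  have "fst (S, snd s) (g r) = 0" using IfFalse by auto
  from exec.IfFalse[OF this 1(1), of "rename g c1"] 1 show ?case by auto
next
  case (WhileFalse s r c)
  then show ?case using exec.WhileFalse[of "(S, snd s)" "g r" w "rename g c"] by auto
next
  case (WhileTrue s r c t1 s' t2 s'')
  from WhileTrue.IH(1)[of S] WhileTrue.prems obtain S1 where
    1: "exec w (rename g c) (S, snd s) t1 (S1, snd s')" "\<forall>r\<in>A. S1 (g r) = fst s' r"
       "\<forall>r. r \<notin> g ` A \<longrightarrow> S1 r = S r" by auto
  from WhileTrue.IH(2)[of S1] WhileTrue.prems 1 obtain S2 where
    2: "exec w (rename g (WhileNz r c)) (S1, snd s') t2 (S2, snd s'')" "\<forall>r\<in>A. S2 (g r) = fst s'' r"
       "\<forall>r. r \<notin> g ` A \<longrightarrow> S2 r = S1 r" by auto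
  have "fst (S, snd s) (g r) \<noteq> 0" using WhileTrue by auto
  from exec.WhileTrue[OF this 1(1)] 1 2 show ?case by auto
qed

section \<open>Orthogonal vectors as a common substring\<close>

text \<open>The numbers \<open>a * 2r\<^sup>2 + a\<^sup>2\<close> with \<open>a < r\<close> form a Sidon set: a nonzero difference of two of them
  determines \<open>a\<close> and \<open>b\<close>. Ones at these positions coincide at most once with a shifted copy.\<close>

definition mark :: "nat \<Rightarrow> nat \<Rightarrow> nat" where
  "mark r a = a * (2 * r ^ 2) + a ^ 2"

text \<open>The codes of a coordinate are 100, 010 (for 0, 1) in the first text and 000, 101 in the
  second. Their Hamming distance is 3 if both coordinates are 1, and 1 otherwise.\<close>

definition coord :: "nat \<Rightarrow> bool \<Rightarrow> nat \<Rightarrow> bool" where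
  "coord s b c \<longleftrightarrow> (if c = 0 then s = of_bool b else b \<and> s + 1 = c)"

text \<open>This is the bound of \<open>mark_less\<close> for \<open>r = 8 * d\<close> marks. With
  that many marks, a misaligned window keeps at least \<open>8 * d - 3 * d - 2 > d\<close>
  mismatches.\<close>

definition zone :: "nat \<Rightarrow> nat" where
  "zone d = 2 * (8 * d) ^ 3"

lemma zone_ge: "3 * d \<le> zone d"
  using self_le_power[of "8 * d" 3] by (cases "d = 0") (auto simp: zone_def)

text \<open>A text has period \<open>2 * zone d\<close>, up to the contents of the codes: a zone with the \<open>8 * d\<close> marks,
  then a zone that starts with the codes of the \<open>d\<close> coordinates of a vector and is 0 otherwise.\<close>

definition text_bit :: "nat \<Rightarrow> (nat \<Rightarrow> nat \<Rightarrow> nat \<Rightarrow> bool) \<Rightarrow> nat \<Rightarrow> nat \<Rightarrow> bool" where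
  "text_bit d U s i = (let y = i mod (2 * zone d); u = i div (2 * zone d); Q = 2 * (8 * d) ^ 2 in
     if y < zone d then y mod Q = (y div Q) ^ 2
     else (y - zone d) div 3 < d \<and> coord s (U s u ((y - zone d) div 3)) ((y - zone d) mod 3))"

section \<open>The marks as a Sidon set\<close>

lemma mark_less: "a < r \<Longrightarrow> mark r a < 2 * r ^ 3"
proof -
  assume a: "a < r"
  have "a ^ 2 < r ^ 2" using a by (intro power_strict_mono) auto
  then have "mark r a < (a + 1) * (2 * r ^ 2)" by (simp add: mark_def)
  also have "\<dots> \<le> r * (2 * r ^ 2)" using a by (intro mult_right_mono) auto
  finally show ?thesis by (simp add: power3_eq_cube power2_eq_square)
qed

text \<open>Differences of two squares below \<open>r ^ 2\<close> have absolute value below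
  \<open>r ^ 2\<close>, so two such differences are less than the spacing \<open>2 * r ^ 2\<close>
  apart and cannot compensate a change of the linear part. Hence \<open>a - b = a' - b'\<close>, and
  dividing the equal differences of squares by this nonzero number gives
  \<open>a + b = a' + b'\<close>. The set is a variant of the Erdos-Turan construction with the
  squares left unreduced.\<close>

lemma mark_diff_inj:
  assumes lt: "a < r" "b < r" "a' < r" "b' < r"
    and eq: "int (mark r a) - int (mark r b) = int (mark r a') - int (mark r b')"
    and ne: "mark r a \<noteq> mark r b"
  shows "a = a'"
proof -
  define Q where "Q = int (2 * r ^ 2)"
  define e where "e = (int a' - int b') - (int a - int b)"
  have sq: "0 \<le> int x ^ 2" "int x ^ 2 < int (r ^ 2)" if "x < r" for x
    using power_strict_mono[of "int x" "int r" 2] that by auto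
  have "e * Q = (int a ^ 2 - int b ^ 2) - (int a' ^ 2 - int b' ^ 2)"
    using eq by (simp add: mark_def e_def Q_def algebra_simps)
  moreover have "\<bar>(int a ^ 2 - int b ^ 2) - (int a' ^ 2 - int b' ^ 2)\<bar> < Q"
    using sq[OF lt(1)] sq[OF lt(2)] sq[OF lt(3)] sq[OF lt(4)]
    unfolding abs_less_iff Q_def of_nat_mult of_nat_numeral by linarith
  ultimately have "\<bar>e\<bar> * \<bar>Q\<bar> < Q" by (simp add: abs_mult[symmetric])
  have "e = 0"
  proof (rule ccontr)
    assume "e \<noteq> 0"
    then have "1 * \<bar>Q\<bar> \<le> \<bar>e\<bar> * \<bar>Q\<bar>" by (intro mult_right_mono) auto
    with \<open>\<bar>e\<bar> * \<bar>Q\<bar> < Q\<close> show False by simp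
  qed
  then have 1: "int a' - int b' = int a - int b" by (simp add: e_def)
  have "int a ^ 2 - int b ^ 2 = int a' ^ 2 - int b' ^ 2"
    using \<open>e * Q = _\<close> \<open>e = 0\<close> by simp
  then have "(int a - int b) * (int a + int b) = (int a' - int b') * (int a' + int b')"
    by (simp add: power2_eq_square algebra_simps)
  moreover have "int a - int b \<noteq> 0" using ne by auto
  ultimately have "int a + int b = int a' + int b'" using 1 by simp
  with 1 show ?thesis by simp
qed

lemma card_mark_shift:
  assumes "z \<noteq> 0"
  shows "card {a. a < r \<and> (\<exists>b<r. int (mark r a) - int (mark r b) = z)} \<le> 1"
proof -
  have "a = a'" if "a \<in> {a. a < r \<and> (\<exists>b<r. int (mark r a) - int (mark r b) = z)}"
    "a' \<in> {a. a < r \<and> (\<exists>b<r. int (mark r a) - int (mark r b) = z)}" for a a'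
    using that assms mark_diff_inj[of a r _ a'] by fastforce
  then show ?thesis by (simp add: card_le_Suc0_iff_eq)
qed

text \<open>\<open>text_bit\<close> tests for a mark by one division, so that a program can do it in
  constant time. A zone consists of \<open>8 * d\<close> blocks of length
  \<open>2 * (8 * d) ^ 2\<close>, so the quotient is the index of a mark; as its square is smaller
  than a block, quotient and remainder determine the mark.\<close>

lemma text_bit_mark:
  assumes "i mod (2 * zone d) < zone d"
  shows "text_bit d U s i \<longleftrightarrow> (\<exists>a < 8 * d. i mod (2 * zone d) = mark (8 * d) a)"
proof -
  define y where "y = i mod (2 * zone d)"
  define Q where "Q = 2 * (8 * d) ^ 2"
  have y: "y < 8 * d * Q" using assms
    by (simp add: y_def zone_def Q_def power3_eq_cube power2_eq_square mult_ac)
  then have Q: "Q > 0" by (cases Q) auto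
  have m: "mark (8 * d) a = a * Q + a ^ 2" for a by (simp only: mark_def Q_def)
  have t: "text_bit d U s i \<longleftrightarrow> y mod Q = (y div Q) ^ 2"
    using assms by (simp add: text_bit_def y_def Q_def Let_def)
  have "y mod Q = (y div Q) ^ 2 \<Longrightarrow> y = mark (8 * d) (y div Q)"
    using div_mult_mod_eq[of y Q] by (simp add: m)
  moreover have "y div Q < 8 * d" using y by (simp add: less_mult_imp_div_less)
  moreover have "y mod Q = (y div Q) ^ 2" if "y = mark (8 * d) a" "a < 8 * d" for a
  proof -
    have "a ^ 2 < Q" using power_strict_mono[of a "8 * d" 2] that(2) by (auto simp: Q_def)
    then have "y div Q = a" "y mod Q = a ^ 2"
      using that(1) by (auto simp: m)
    then show ?thesis by simp
  qed
  ultimately show ?thesis unfolding t y_def[symmetric] by metis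
qed

lemma text_bit_coord:
  assumes "j < d" "c < 3"
  shows "text_bit d U s (u * (2 * zone d) + zone d + 3 * j + c) = coord s (U s u j) c"
proof -
  have l: "zone d + 3 * j + c < 2 * zone d" using assms zone_ge[of d] by linarith
  define y where "y = zone d + 3 * j + c"
  have yl: "y < 2 * zone d" using l by (simp add: y_def)
  have "text_bit d U s (u * (2 * zone d) + y) = coord s (U s u j) c"
    using yl assms by (simp add: text_bit_def Let_def) (auto simp: y_def)
  then show ?thesis by (simp add: y_def add.assoc)
qed

section \<open>Windows of different phase\<close>

lemma mod_eq_split:
  fixes y a m :: nat
  assumes "y < m" "a < m"
  shows "(y + a) mod m = y + a \<or> (y + a) mod m + m = y + a"
  using assms by (cases "y + a < m") (auto simp: le_mod_geq)

text \<open>The window contains all \<open>8 * d\<close> marks of some marker zone of the first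
  text. Opposite to them the second text is read at a nonzero shift \<open>y\<close>, where a one is
  either a mark, reached with or without wrapping around the period and hence at most twice, or one
  of the \<open>3 * d\<close> code positions. All other marks face a zero.\<close>

lemma text_bit_misaligned:
  assumes d: "d > 0" and mis: "i mod (2 * zone d) \<noteq> j mod (2 * zone d)"
  shows "card {x. x < 3 * zone d \<and> text_bit d U 0 (i + x) \<noteq> text_bit d U 1 (j + x)} > d"
    (is "card ?X > d")
proof -
  define D where "D = zone d"
  define r where "r = 8 * d"
  have Dr: "D = 2 * r ^ 3" by (simp add: D_def zone_def r_def)
  have Dpos: "D > 0" using d by (simp add: D_def zone_def)
  \<comment> \<open>the first marker zone of \<open>T1\<close> inside the window starts at \<open>i + x0\<close>\<close>
  define x0 where "x0 = (2 * D - i mod (2 * D)) mod (2 * D)"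
  have x0: "x0 < 2 * D" "(i + x0) mod (2 * D) = 0"
  proof -
    show "x0 < 2 * D" using Dpos by (simp add: x0_def)
    have "(i + x0) mod (2 * D) = (i mod (2 * D) + (2 * D - i mod (2 * D))) mod (2 * D)"
      unfolding x0_def by (metis mod_add_left_eq mod_add_right_eq)
    also have "\<dots> = 0" using Dpos by (simp add: less_imp_le)
    finally show "(i + x0) mod (2 * D) = 0" .
  qed
  define y where "y = (j + x0) mod (2 * D)"
  have y0: "y \<noteq> 0"
  proof
    assume "y = 0"
    then have "(i + x0) mod (2 * D) = (j + x0) mod (2 * D)" using x0 by (simp add: y_def)
    then have "(i + x0 + (2 * D - x0)) mod (2 * D) = (j + x0 + (2 * D - x0)) mod (2 * D)"
      by (metis mod_add_left_eq)
    then have "i mod (2 * D) = j mod (2 * D)" using x0(1) by simp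
    with mis show False by (simp add: D_def)
  qed
  have y: "y < 2 * D" using Dpos by (simp add: y_def)
  have mk: "mark r a < D" if "a < r" for a using mark_less[OF that] Dr by simp
  have inj: "inj_on (mark r) {..<r}"
  proof (rule inj_onI)
    fix a b assume "a \<in> {..<r}" "b \<in> {..<r}" and e: "mark r a = mark r b"
    show "a = b"
    proof (rule ccontr)
      assume "a \<noteq> b"
      have *: "mark r a < mark r b" if "a < b" for a b
        using that by (auto simp: mark_def intro!: add_le_less_mono mult_right_mono power_strict_mono)
      from *[of a b] *[of b a] e \<open>a \<noteq> b\<close> show False by (cases "a < b") auto
    qed
  qed
  define E where "E = {a. a < r \<and> text_bit d U 1 (j + (x0 + mark r a))}"
  have one: "text_bit d U 0 (i + (x0 + mark r a))" if "a < r" for a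
  proof -
    have "(i + (x0 + mark r a)) mod (2 * D) = ((i + x0) mod (2 * D) + mark r a) mod (2 * D)"
      by (simp add: mod_add_left_eq add.assoc)
    also have "\<dots> = mark r a" using x0 mk[OF that] by simp
    finally show ?thesis using text_bit_mark[of "i + (x0 + mark r a)" d U 0] mk[OF that] that
      by (auto simp: D_def r_def)
  qed
  have sh: "(j + (x0 + mark r a)) mod (2 * D) = (y + mark r a) mod (2 * D)" for a
    by (simp add: y_def mod_add_left_eq add.assoc)
  \<comment> \<open>The marks of the first text that may face a one: \<open>E1\<close> meets a mark
    of the second text within the same period, \<open>E2\<close> one after wrapping around, and
    \<open>E3\<close> falls into the codes.\<close>
  define E1 where "E1 = {a. a < r \<and> (\<exists>b<r. int (mark r a) - int (mark r b) = - int y)}"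
  define E2 where "E2 = {a. a < r \<and> (\<exists>b<r. int (mark r a) - int (mark r b) = int (2 * D) - int y)}"
  define E3 where "E3 = {a. a < r \<and> D \<le> (y + mark r a) mod (2 * D) \<and> (y + mark r a) mod (2 * D) < D + 3 * d}"
  have E: "E \<subseteq> E1 \<union> E2 \<union> E3"
  proof
    fix a assume "a \<in> E"
    then have a: "a < r" "text_bit d U 1 (j + (x0 + mark r a))" by (auto simp: E_def)
    have sp: "(y + mark r a) mod (2 * D) = y + mark r a \<or> (y + mark r a) mod (2 * D) + 2 * D = y + mark r a"
      using mod_eq_split[of y "2 * D" "mark r a"] y mk[OF a(1)] by simp
    show "a \<in> E1 \<union> E2 \<union> E3"
    proof (cases "(y + mark r a) mod (2 * D) < D")
      case True
      then obtain b where b: "b < r" "(y + mark r a) mod (2 * D) = mark r b"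
        using text_bit_mark[of "j + (x0 + mark r a)" d U 1] a(2) sh[of a] by (auto simp: D_def r_def)
      from sp have "int (mark r a) - int (mark r b) = - int y \<or>
          int (mark r a) - int (mark r b) = int (2 * D) - int y"
        unfolding b(2) by linarith
      then show ?thesis using a(1) b(1) by (auto simp: E1_def E2_def)
    next
      case False
      then have "((y + mark r a) mod (2 * D) - D) div 3 < d"
        using a(2) sh[of a] by (simp add: text_bit_def Let_def D_def)
      then show ?thesis using False a(1) by (auto simp: E3_def)
    qed
  qed
  have "card E1 \<le> 1" "card E2 \<le> 1"
    unfolding E1_def E2_def using y0 y by (intro card_mark_shift; simp)+
  moreover have "card E3 \<le> 3 * d"
  proof -
    have "card E3 \<le> card {D..<D + 3 * d}"
    proof (rule card_inj_on_le)
      show "inj_on (\<lambda>a. (y + mark r a) mod (2 * D)) E3"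
      proof (rule inj_onI)
        fix a b assume ab: "a \<in> E3" "b \<in> E3" and e: "(y + mark r a) mod (2 * D) = (y + mark r b) mod (2 * D)"
        then have l: "a < r" "b < r" by (auto simp: E3_def)
        have "mark r a = mark r b"
          using mod_eq_split[of y "2 * D" "mark r a"] mod_eq_split[of y "2 * D" "mark r b"] y
            mk[OF l(1)] mk[OF l(2)] e by linarith
        then show "a = b" using inj l by (auto dest: inj_onD)
      qed
    qed (auto simp: E3_def)
    then show ?thesis by simp
  qed
  moreover have fin: "finite E1" "finite E2" "finite E3" by (auto simp: E1_def E2_def E3_def)
  then have "card E \<le> card (E1 \<union> E2 \<union> E3)" using E by (intro card_mono) auto
  moreover have "card (E1 \<union> E2 \<union> E3) \<le> card E1 + card E2 + card E3"
    by (meson card_Un_le add_right_mono order_trans)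
  ultimately have cE: "card E \<le> 2 + 3 * d" by linarith
  have "(\<lambda>a. x0 + mark r a) ` ({..<r} - E) \<subseteq> ?X"
  proof (rule image_subsetI)
    fix a assume "a \<in> {..<r} - E"
    then have a: "a < r" "\<not> text_bit d U 1 (j + (x0 + mark r a))" by (auto simp: E_def)
    have "x0 + mark r a < 3 * D" using x0(1) mk[OF a(1)] by linarith
    with a(2) one[OF a(1)] show "x0 + mark r a \<in> ?X" unfolding D_def by blast
  qed
  moreover have "inj_on (\<lambda>a. x0 + mark r a) ({..<r} - E)"
    using inj by (auto simp: inj_on_def)
  ultimately have "card ({..<r} - E) \<le> card ?X"
    by (intro card_inj_on_le) auto
  moreover have "card ({..<r} - E) = r - card E"
    by (subst card_Diff_subset) (auto simp: E_def)
  ultimately show ?thesis using cE d by (simp add: r_def)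
qed

section \<open>Coordinate codes and windows of equal phase\<close>

text \<open>The position within a coordinate gadget at which the codes of \<open>a\<close> and \<open>b\<close> always differ.\<close>

definition pivot :: "bool \<Rightarrow> bool \<Rightarrow> nat" where
  "pivot a b = (if a then 1 else if b then 2 else 0)"

lemma pivot_less: "pivot a b < 3"
  by (simp add: pivot_def)

lemma coord_diff_iff:
  "\<not> (a \<and> b) \<Longrightarrow> c < 3 \<Longrightarrow> coord 0 a c \<noteq> coord 1 b c \<longleftrightarrow> c = pivot a b"
  by (auto simp: coord_def pivot_def)

lemma coord_diff_pivot: "coord 0 a (pivot a b) \<noteq> coord 1 b (pivot a b)"
  by (auto simp: coord_def pivot_def)

text \<open>In both texts the window reads a marker zone, a vector zone and a marker zone. The marks
  are the same for all vectors, so mismatches occur only inside the codes, one per coordinate, at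
  its pivot.\<close>

lemma text_bit_orthogonal:
  assumes "\<And>j. j < d \<Longrightarrow> \<not> (U 0 u j \<and> U 1 v j)"
  shows "card {x. x < 3 * zone d \<and>
    text_bit d U 0 (u * (2 * zone d) + x) \<noteq> text_bit d U 1 (v * (2 * zone d) + x)} \<le> d"
    (is "card ?X \<le> d")
proof -
  define D where "D = zone d"
  let ?g = "\<lambda>j. D + 3 * j + pivot (U 0 u j) (U 1 v j)"
  have "?X \<subseteq> ?g ` {..<d}"
  proof
    fix x assume "x \<in> ?X"
    then have x: "x < 3 * D" "text_bit d U 0 (u * (2 * D) + x) \<noteq> text_bit d U 1 (v * (2 * D) + x)"
      by (auto simp: D_def)
    have *: "(k * (2 * D) + x) mod (2 * D) = x mod (2 * D)" for k by simp
    have ge: "\<not> x mod (2 * D) < D"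
      using text_bit_mark[of "u * (2 * D) + x" d U 0] text_bit_mark[of "v * (2 * D) + x" d U 1] x(2)
      unfolding D_def[symmetric] * by blast
    have x2: "x < 2 * D" "D \<le> x"
    proof -
      show "x < 2 * D"
      proof (rule ccontr)
        assume "\<not> x < 2 * D"
        then have "x mod (2 * D) = x - 2 * D" using x(1) by (simp add: le_mod_geq)
        with ge x(1) \<open>\<not> x < 2 * D\<close> show False by linarith
      qed
      with ge show "D \<le> x" by simp
    qed
    have jd: "(x - D) div 3 < d"
    proof (rule ccontr)
      assume "\<not> (x - D) div 3 < d"
      then have "\<not> text_bit d U s (k * (2 * D) + x)" for k s
        using x2 by (simp add: text_bit_def Let_def D_def[symmetric])
      with x(2) show False by blast
    qed
    define j c where "j = (x - D) div 3" and "c = (x - D) mod 3"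
    have xe: "x = D + 3 * j + c" using x2 by (simp add: j_def c_def)
    have c: "c < 3" by (simp add: c_def)
    have "text_bit d U s (k * (2 * D) + x) = coord s (U s k j) c" for s k
      using text_bit_coord[of j d c U s k] jd c by (simp add: D_def[symmetric] xe j_def[symmetric] add.assoc)
    then have "coord 0 (U 0 u j) c \<noteq> coord 1 (U 1 v j) c" using x(2) by simp
    then have "c = pivot (U 0 u j) (U 1 v j)"
      using coord_diff_iff c assms[of j] jd by (auto simp: j_def[symmetric])
    then show "x \<in> ?g ` {..<d}" using xe jd by (auto simp: j_def[symmetric])
  qed
  then have "card ?X \<le> card (?g ` {..<d})" by (intro card_mono) auto
  also have "\<dots> \<le> d" using card_image_le[of "{..<d}" ?g] by simp
  finally show ?thesis .
qed

text \<open>The two windows contain a complete vector zone at the same offset. The pivots of its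
  coordinates already account for \<open>d\<close> mismatches, so a coordinate with two ones, which
  mismatches at a further position, would exceed the budget. The bounds on \<open>u\<close> and
  \<open>v\<close> say that these vector zones end inside the windows.\<close>

lemma text_bit_aligned:
  assumes d: "d > 0" and al: "i mod (2 * zone d) = j mod (2 * zone d)"
    and card: "card {x. x < 3 * zone d \<and> text_bit d U 0 (i + x) \<noteq> text_bit d U 1 (j + x)} \<le> d"
      (is "card ?X \<le> d")
  obtains u v where "u * (2 * zone d) + 2 * zone d \<le> i + 3 * zone d"
    "v * (2 * zone d) + 2 * zone d \<le> j + 3 * zone d" "\<And>l. l < d \<Longrightarrow> \<not> (U 0 u l \<and> U 1 v l)"
proof -
  define D where "D = zone d"
  have Dpos: "D > 0" using d by (simp add: D_def zone_def)
  have d3: "3 * d \<le> D" by (simp add: D_def zone_ge)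
  define q where "q = i mod (2 * D)"
  \<comment> \<open>The vector zone of the current period is complete if the window starts no later
    than this zone does; otherwise the one of the next period is taken.\<close>
  define e where "e = (if q \<le> D then 0 else 1::nat)"
  have q: "q < 2 * D" using Dpos by (simp add: q_def)
  define u where "u = i div (2 * D) + e"
  define v where "v = j div (2 * D) + e"
  define x0 where "x0 = e * (2 * D) + D - q"
  have e: "q \<le> e * (2 * D) + D" "x0 + D \<le> 3 * D"
    using q by (auto simp: e_def x0_def)
  have ix: "i + x0 = u * (2 * D) + D"
  proof -
    have "i = i div (2 * D) * (2 * D) + q" unfolding q_def by (simp only: div_mult_mod_eq)
    moreover have "u * (2 * D) = i div (2 * D) * (2 * D) + e * (2 * D)"
      by (simp add: u_def algebra_simps)
    ultimately show ?thesis using e(1) unfolding x0_def by linarith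
  qed
  have jx: "j + x0 = v * (2 * D) + D"
  proof -
    have "q = j mod (2 * D)" using al by (simp add: q_def D_def)
    then have "j = j div (2 * D) * (2 * D) + q" by (metis div_mult_mod_eq)
    moreover have "v * (2 * D) = j div (2 * D) * (2 * D) + e * (2 * D)"
      by (simp add: v_def algebra_simps)
    ultimately show ?thesis using e(1) unfolding x0_def by linarith
  qed
  have tb: "text_bit d U 0 (i + (x0 + 3 * l + c)) = coord 0 (U 0 u l) c"
      "text_bit d U 1 (j + (x0 + 3 * l + c)) = coord 1 (U 1 v l) c" if "l < d" "c < 3" for l c
    using text_bit_coord[OF that, of U 0 u] text_bit_coord[OF that, of U 1 v] ix jx
    by (simp_all add: D_def[symmetric] add.assoc[symmetric])
  let ?g = "\<lambda>l. x0 + 3 * l + pivot (U 0 u l) (U 1 v l)"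
  have lt: "x0 + 3 * l + c < 3 * D" if "l < d" "c < 3" for l c
    using that e(2) d3 by linarith
  have sub: "?g ` {..<d} \<subseteq> ?X"
    using tb coord_diff_pivot pivot_less lt by (auto simp: D_def[symmetric] add.assoc)
  have ginj: "l = l'" if "3 * l + c = 3 * l' + c'" "c < 3" "c' < 3" for l l' c c' :: nat
    using that by linarith
  have "inj_on ?g {..<d}"
  proof (rule inj_onI)
    fix l l' assume "?g l = ?g l'"
    then have "3 * l + pivot (U 0 u l) (U 1 v l) = 3 * l' + pivot (U 0 u l') (U 1 v l')" by linarith
    then show "l = l'" using ginj pivot_less by blast
  qed
  then have cg: "card (?g ` {..<d}) = d" by (simp add: card_image)
  have "\<not> (U 0 u l \<and> U 1 v l)" if l: "l < d" for l
  proof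
    \<comment> \<open>For two ones the codes are 010 and 101: the pivot is the middle position, and
      the first position mismatches as well.\<close>
    assume b: "U 0 u l \<and> U 1 v l"
    then have "x0 + 3 * l \<in> ?X"
      using tb[OF l, of 0] lt[OF l, of 0] by (auto simp: coord_def D_def[symmetric])
    moreover have "x0 + 3 * l \<notin> ?g ` {..<d}"
    proof
      assume "x0 + 3 * l \<in> ?g ` {..<d}"
      then obtain l' where l': "3 * l + 0 = 3 * l' + pivot (U 0 u l') (U 1 v l')" by auto
      then have "l = l'" using ginj[OF l'] pivot_less by simp
      with l' b show False by (simp add: pivot_def)
    qed
    ultimately have "insert (x0 + 3 * l) (?g ` {..<d}) \<subseteq> ?X" using sub by blast
    then have "card (insert (x0 + 3 * l) (?g ` {..<d})) \<le> card ?X" by (intro card_mono) auto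
    then show False using card cg \<open>x0 + 3 * l \<notin> ?g ` {..<d}\<close> by simp
  qed
  moreover have "u * (2 * D) + 2 * D \<le> i + 3 * D" "v * (2 * D) + 2 * D \<le> j + 3 * D"
    using ix jx e(2) by linarith+
  ultimately show ?thesis using that by (auto simp: D_def)
qed

text \<open>One more marker zone follows the last vector, so that every vector has a marker zone on both sides.\<close>

definition gadget_text :: "nat \<Rightarrow> nat \<Rightarrow> (nat \<Rightarrow> nat \<Rightarrow> nat \<Rightarrow> bool) \<Rightarrow> nat \<Rightarrow> bool list" where
  "gadget_text N d U s = map (text_bit d U s) [0..<zone d * (2 * N + 1)]"

lemma length_gadget_text: "length (gadget_text N d U s) = zone d * (2 * N + 1)"
  by (simp add: gadget_text_def)

text \<open>A prefix of a common window has no more mismatches than the window, so a longest pair of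
  at least three zones can be cut down to exactly three. Conversely, an orthogonal pair provides a
  common window of three zones, and maximality does the rest.\<close>

lemma gadget_text_longest_iff:
  fixes N :: nat
  assumes d: "d > 0" and L: "L = zone d * (2 * N + 1)"
    and ab: "a + l \<le> L" "b + l \<le> L"
    and lc: "longest_common_k d (gadget_text N d U 0) (gadget_text N d U 1)
      (take l (drop a (gadget_text N d U 0))) (take l (drop b (gadget_text N d U 1)))"
  shows "3 * zone d \<le> l \<longleftrightarrow> (\<exists>u<N. \<exists>v<N. \<forall>j<d. \<not> (U 0 u j \<and> U 1 v j))"
proof -
  define D where "D = zone d"
  have Dpos: "D > 0" using d by (simp add: D_def zone_def)
  let ?T = "gadget_text N d U"
  have len: "length (?T s) = L" for s by (simp add: length_gadget_text L)
  have nth: "?T s ! i = text_bit d U s i" if "i < L" for i s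
    using that L by (simp add: gadget_text_def)
  have ham: "hamming (take n (drop i (?T 0))) (take n (drop j (?T 1))) =
      card {x. x < n \<and> text_bit d U 0 (i + x) \<noteq> text_bit d U 1 (j + x)}"
    if "i + n \<le> L" "j + n \<le> L" for i j n
    unfolding hamming_def using that
    by (intro arg_cong[where f = card]) (auto simp: len nth)
  show ?thesis
  proof
    assume l: "3 * zone d \<le> l"
    have "hamming (take l (drop a (?T 0))) (take l (drop b (?T 1))) \<le> d"
      using lc by (simp add: longest_common_k_def common_k_def)
    then have 1: "card {x. x < l \<and> text_bit d U 0 (a + x) \<noteq> text_bit d U 1 (b + x)} \<le> d"
      using ham ab by simp
    have "card {x. x < 3 * zone d \<and> text_bit d U 0 (a + x) \<noteq> text_bit d U 1 (b + x)} \<le>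
        card {x. x < l \<and> text_bit d U 0 (a + x) \<noteq> text_bit d U 1 (b + x)}"
      using l by (intro card_mono) auto
    with 1 have 2: "card {x. x < 3 * zone d \<and> text_bit d U 0 (a + x) \<noteq> text_bit d U 1 (b + x)} \<le> d"
      by simp
    then have "a mod (2 * zone d) = b mod (2 * zone d)"
      using text_bit_misaligned[OF d, of a b U] by linarith
    from text_bit_aligned[OF d this 2] obtain u v where
      uv: "u * (2 * zone d) + 2 * zone d \<le> a + 3 * zone d"
        "v * (2 * zone d) + 2 * zone d \<le> b + 3 * zone d" "\<And>l. l < d \<Longrightarrow> \<not> (U 0 u l \<and> U 1 v l)"
      by blast
    \<comment> \<open>A vector zone ends after an even number of zones, so one that ends within the
      \<open>2 * N + 1\<close> zones of the text has an index below \<open>N\<close>.\<close>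
    have "u < N" if "u * (2 * zone d) + 2 * zone d \<le> a + 3 * zone d" "a + l \<le> L" for u a
    proof -
      have "(2 * (u + 1)) * D \<le> (2 * N + 1) * D"
        using that l by (simp add: L D_def[symmetric] algebra_simps)
      then have "2 * (u + 1) \<le> 2 * N + 1" using Dpos by (simp only: mult_le_cancel2)
      then show ?thesis by simp
    qed
    with uv ab show "\<exists>u<N. \<exists>v<N. \<forall>j<d. \<not> (U 0 u j \<and> U 1 v j)" by blast
  next
    assume "\<exists>u<N. \<exists>v<N. \<forall>j<d. \<not> (U 0 u j \<and> U 1 v j)"
    then obtain u v where uv: "u < N" "v < N" "\<forall>j<d. \<not> (U 0 u j \<and> U 1 v j)" by blast
    have fits: "u * (2 * D) + 3 * D \<le> L" if "u < N" for u
    proof -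
      have "D * (2 * u + 3) \<le> D * (2 * N + 1)" using that by (intro mult_left_mono) auto
      then show ?thesis by (simp add: L D_def[symmetric] algebra_simps)
    qed
    let ?S = "\<lambda>s u. take (3 * D) (drop (u * (2 * D)) (?T s))"
    have "hamming (?S 0 u) (?S 1 v) \<le> d"
      using ham[OF fits[OF uv(1)] fits[OF uv(2)]] text_bit_orthogonal[of d U u v] uv(3)
      by (simp add: D_def)
    moreover have "sublist (?S s u) (?T s)" for s u
      by (metis sublist_drop sublist_order.order_trans sublist_take)
    ultimately have "common_k d (?T 0) (?T 1) (?S 0 u) (?S 1 v)"
      using fits[OF uv(1)] fits[OF uv(2)] by (simp add: common_k_def len)
    then have "length (?S 0 u) \<le> length (take l (drop a (?T 0)))"
      using lc by (auto simp: longest_common_k_def)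
    then show "3 * zone d \<le> l" using fits[OF uv(1)] by (simp add: len D_def)
  qed
qed

section \<open>The reduction program\<close>

definition clause_offset :: "(nat \<times> bool) list list \<Rightarrow> nat \<Rightarrow> nat" where
  "clause_offset F j = 2 + (\<Sum>C\<leftarrow>take j F. Suc (length C))"

text \<open>Variable \<open>x\<close> belongs to half \<open>x div h\<close> and is bit
  \<open>x mod h\<close> of the number that encodes the assignment, so the same arithmetic serves
  both halves. Beyond the last clause the value is false, which makes padding coordinates
  harmless.\<close>

definition half_unsat :: "nat \<Rightarrow> (nat \<times> bool) list list \<Rightarrow> nat \<Rightarrow> nat \<Rightarrow> nat \<Rightarrow> bool" where
  "half_unsat h F s u j \<longleftrightarrow> j < length F \<and>
    (\<forall>l<length (F ! j). \<not> (fst (F ! j ! l) div h = s \<and> bit u (fst (F ! j ! l) mod h) = snd (F ! j ! l)))"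

lemma clause_offset_ge: "j \<le> length F \<Longrightarrow> j + 2 \<le> clause_offset F j"
  by (simp add: clause_offset_def sum_list_Suc)

lemma concat_nth_offset:
  "j < length xs \<Longrightarrow> l < length (xs ! j) \<Longrightarrow>
    concat xs ! ((\<Sum>x\<leftarrow>take j xs. length x) + l) = xs ! j ! l"
proof (induction xs arbitrary: j)
  case (Cons x xs)
  then show ?case by (cases j) (auto simp: nth_append add.assoc)
qed simp

lemma clause_offset_Suc:
  "j < length F \<Longrightarrow> clause_offset F (Suc j) = clause_offset F j + Suc (length (F ! j))"
  by (simp add: clause_offset_def take_Suc_conv_app_nth)

lemma length_enc_cnf: "length (enc_cnf (n, F)) = clause_offset F (length F)"
  by (simp add: enc_cnf_def clause_offset_def length_concat comp_def)

lemma clause_offset_mono: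
  assumes "i \<le> j"
  shows "clause_offset F i \<le> clause_offset F j"
proof -
  have "take j F = take i F @ take (j - i) (drop i F)"
    using assms by (metis le_add_diff_inverse take_add)
  then show ?thesis by (simp add: clause_offset_def)
qed

lemma clause_offset_less:
  assumes "j < length F"
  shows "clause_offset F j + length (F ! j) < length (enc_cnf (n, F))"
  using clause_offset_mono[of "Suc j" "length F" F] assms
  by (simp add: clause_offset_Suc length_enc_cnf)

lemma enc_cnf_clause:
  assumes "j < length F" "l \<le> length (F ! j)"
  shows "enc_cnf (n, F) ! (clause_offset F j + l) =
    (if l = 0 then length (F ! j) else 2 * fst (F ! j ! (l - 1)) + of_bool (snd (F ! j ! (l - 1))))"
proof -
  let ?g = "\<lambda>C. length C # map (\<lambda>(v, b). 2 * v + of_bool b) C :: nat list"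
  have "(\<Sum>x\<leftarrow>take j (map ?g F). length x) = (\<Sum>C\<leftarrow>take j F. Suc (length C))"
    by (simp add: take_map comp_def)
  then have "enc_cnf (n, F) ! (clause_offset F j + l) = map ?g F ! j ! l"
    using concat_nth_offset[of j "map ?g F" l] assms by (simp add: enc_cnf_def clause_offset_def)
  then show ?thesis using assms by (cases l) (auto simp: split_beta)
qed

section \<open>Splitting assignments into two halves\<close>

lemma ex_bits: "\<exists>u<2 ^ h. \<forall>x<h. bit (u::nat) x = \<alpha> x"
proof -
  let ?u = "take_bit h (horner_sum of_bool 2 (map \<alpha> [0..<h])) :: nat"
  have "bit ?u x = \<alpha> x" if "x < h" for x
    using that by (simp add: bit_take_bit_iff bit_horner_sum_bit_iff)
  then show ?thesis using take_bit_nat_less_exp by blast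
qed

text \<open>Orthogonality at \<open>j\<close> says that one of the halves makes a literal of clause
  \<open>j\<close> true. As \<open>n \<le> 2 * h\<close>, every variable falls into half 0 or half
  1. If \<open>n\<close> is odd, the second half has a surplus bit; this allows the same number
  \<open>2 ^ h\<close> of vectors in both texts.\<close>

lemma satisfiable_iff_halves:
  assumes F: "(n, F) \<in> q_cnf q" and d: "length F \<le> d" and h: "h = n - n div 2"
  shows "satisfiable (n, F) \<longleftrightarrow>
    (\<exists>u<2 ^ h. \<exists>v<2 ^ h. \<forall>j<d. \<not> (half_unsat h F 0 u j \<and> half_unsat h F 1 v j))"
proof
  assume "satisfiable (n, F)"
  then obtain \<alpha> where \<alpha>: "\<forall>C\<in>set F. \<exists>(v, b)\<in>set C. \<alpha> v = b" by (auto simp: satisfiable_def)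
  obtain u v :: nat where uv: "u < 2 ^ h" "v < 2 ^ h" "\<forall>x<h. bit u x = \<alpha> x" "\<forall>x<h. bit v x = \<alpha> (h + x)"
    using ex_bits[of h \<alpha>] ex_bits[of h "\<lambda>x. \<alpha> (h + x)"] by blast
  have "\<not> (half_unsat h F 0 u j \<and> half_unsat h F 1 v j)" for j
  proof (cases "j < length F")
    case True
    then have "F ! j \<in> set F" by simp
    then obtain x b where xb: "(x, b) \<in> set (F ! j)" "\<alpha> x = b" using \<alpha> by fastforce
    then obtain l where l: "l < length (F ! j)" "F ! j ! l = (x, b)" by (auto simp: in_set_conv_nth)
    have "x < n" using F \<open>F ! j \<in> set F\<close> xb(1) by (fastforce simp: q_cnf_def)
    then have x: "x < 2 * h" "0 < h" by (auto simp: h)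
    show ?thesis
    proof (cases "x < h")
      case True
      then have "x div h = 0" "bit u (x mod h) = b" using uv(3) xb(2) by auto
      with l show ?thesis by (force simp: half_unsat_def)
    next
      case False
      then have "x = h + (x - h)" "x - h < h" using x by auto
      then have "x div h = 1" "x mod h = x - h"
        using x by (simp_all add: le_div_geq le_mod_geq)
      moreover have "bit v (x - h) = b" using uv(4) xb(2) \<open>x - h < h\<close> False by auto
      ultimately show ?thesis using l by (force simp: half_unsat_def)
    qed
  qed (simp add: half_unsat_def)
  with uv(1,2) show "\<exists>u<2 ^ h. \<exists>v<2 ^ h. \<forall>j<d. \<not> (half_unsat h F 0 u j \<and> half_unsat h F 1 v j)"
    by blast
next
  assume "\<exists>u<2 ^ h. \<exists>v<2 ^ h. \<forall>j<d. \<not> (half_unsat h F 0 u j \<and> half_unsat h F 1 v j)"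
  then obtain u v :: nat where uv: "\<forall>j<d. \<not> (half_unsat h F 0 u j \<and> half_unsat h F 1 v j)" by blast
  define \<alpha> where "\<alpha> x = (if x div h = 0 then bit u (x mod h) else bit v (x mod h))" for x
  have "\<exists>(x, b)\<in>set C. \<alpha> x = b" if "C \<in> set F" for C
  proof -
    obtain j where j: "j < length F" "F ! j = C" using \<open>C \<in> set F\<close> by (auto simp: in_set_conv_nth)
    then have "\<not> half_unsat h F 0 u j \<or> \<not> half_unsat h F 1 v j" using uv d by auto
    then obtain s w l where l: "l < length C" "fst (C ! l) div h = s" "bit w (fst (C ! l) mod h) = snd (C ! l)"
        "s = 0 \<and> w = u \<or> s = 1 \<and> w = v"
      using j unfolding half_unsat_def by blast
    then have "\<alpha> (fst (C ! l)) = snd (C ! l)" by (auto simp: \<alpha>_def)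
    with l(1) show ?thesis by (intro bexI[of _ "C ! l"]) (auto simp: case_prod_beta)
  qed
  then show "satisfiable (n, F)" by (auto simp: satisfiable_def)
qed

section \<open>Evaluating \<open>half_unsat\<close> on the word RAM\<close>

definition decr :: "nat \<Rightarrow> expr" where
  "decr r = Bin Minus (Reg r) (Num 1)"

lemma vars_decr [simp]: "vars (decr r) = {r}"
  by (simp add: decr_def)

lemma cost_decr [simp]: "cost (decr r) = 3"
  by (simp add: decr_def)

lemma word_minus: "y \<le> x \<Longrightarrow> x < 2 ^ w \<Longrightarrow> nat ((int x - int y) mod 2 ^ w) = x - y"
proof -
  assume "y \<le> x" "x < 2 ^ w"
  then have "int y \<le> int x" "int x < 2 ^ w" by simp_all
  then have "(int x - int y) mod 2 ^ w = int x - int y"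
    by (intro mod_pos_pos_trivial) linarith+
  with \<open>y \<le> x\<close> show ?thesis by simp
qed

lemma val_decr:
  assumes "0 < V r" "V r < 2 ^ w"
  shows "val w V M (decr r) = V r - 1"
proof -
  have "w > 0" using assms by (cases w) auto
  then have "val w V M (decr r) = nat ((int (V r) - int 1) mod 2 ^ w)"
    by (simp add: decr_def)
  also have "\<dots> = V r - 1" using assms by (subst word_minus) auto
  finally show ?thesis .
qed

lemma small_mod: "3 \<le> w \<Longrightarrow> k < 8 \<Longrightarrow> k mod 2 ^ w = (k::nat)"
  using power_increasing[of 3 w "2::nat"] by simp

lemma bool_mod: "3 \<le> w \<Longrightarrow> of_bool P mod 2 ^ w = (of_bool P :: nat)"
  by (cases P) (auto simp: small_mod)

text \<open>The encoding has no table of clause addresses, so a clause is found by walking along the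
  length fields. This costs a factor linear in the number of clauses for every text bit.\<close>

definition skip_clauses :: com where
  "skip_clauses = WhileNz 17 (Seq
     (assign 16 (Bin Plus (Reg 16) (Bin Plus (Mem (Reg 16)) (Num 1)))) (assign 17 (decr 17)))"

text \<open>The product of two truth values is their conjunction; without branches, the whole test
  is a single expression of constant cost.\<close>

definition lit_true :: expr where
  "lit_true = Bin Times
     (Bin Equal (Bin Div (Bin Div (Reg 18) (Num 2)) (Reg 2)) (Reg 10))
     (Bin Equal (Bin Mod (Bin Shr (Reg 11) (Bin Mod (Bin Div (Reg 18) (Num 2)) (Reg 2))) (Num 2))
        (Bin Mod (Reg 18) (Num 2)))"

definition test_clause :: com where
  "test_clause = WhileNz 17 (Seq (assign 16 (Bin Plus (Reg 16) (Num 1)))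
     (Seq (assign 18 (Mem (Reg 16)))
     (Seq (assign 14 (Bin Times (Reg 14) (Bin Equal lit_true (Num 0)))) (assign 17 (decr 17)))))"

text \<open>Register 14 is first the guard and then the accumulator: the comparison leaves the 1
  that \<open>test_clause\<close> starts from, or else the 0 that is already the answer for a
  padding coordinate.\<close>

definition unsat_prog :: com where
  "unsat_prog = Seq (assign 14 (Bin Less (Reg 13) (Reg 1))) (IfNz 14
     (Seq (assign 16 (Num 2)) (Seq (assign 17 (Reg 13)) (Seq skip_clauses
       (Seq (assign 17 (Mem (Reg 16))) test_clause)))) Skip)"

definition holds_list :: "(nat \<Rightarrow> nat) \<Rightarrow> nat list \<Rightarrow> bool" where
  "holds_list M xs \<longleftrightarrow> (\<forall>i<length xs. M i = xs ! i)"

lemma runs_skip_clauses: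
  assumes w: "3 \<le> w" "length (enc_cnf (n, F)) < 2 ^ w" and M: "holds_list M (enc_cnf (n, F))"
    and j: "j < length F" and V: "V 16 = 2" "V 17 = j"
    and Q: "\<And>V' t'. V' 16 = clause_offset F j \<Longrightarrow> \<forall>r. r \<notin> {16, 17} \<longrightarrow> V' r = V r \<Longrightarrow>
      t' \<le> t + 12 * j + 1 \<Longrightarrow> Q V' M t'"
  shows "runs w skip_clauses V M t Q"
  unfolding skip_clauses_def
proof (rule runs_While[where n = j and I = "\<lambda>i V' M' t'. M' = M \<and> V' 17 = i \<and>
    V' 16 = clause_offset F (j - i) \<and> (\<forall>r. r \<notin> {16, 17} \<longrightarrow> V' r = V r) \<and> t' + 12 * i \<le> t + 12 * j"],
    goal_cases)
  case 2
  then show ?case using V by (auto simp: clause_offset_def)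
next
  case (3 i V' M' t')
  let ?k = "j - Suc i"
  have k: "?k < length F" "j - i = Suc ?k" using 3 j by auto
  have o: "clause_offset F (j - i) = clause_offset F ?k + Suc (length (F ! ?k))"
    unfolding k(2) by (rule clause_offset_Suc[OF k(1)])
  have "clause_offset F ?k + length (F ! ?k) < length (enc_cnf (n, F))"
    by (rule clause_offset_less[OF k(1)])
  then have b: "clause_offset F ?k + Suc (length (F ! ?k)) < 2 ^ w" "Suc (length (F ! ?k)) < 2 ^ w"
      "M (clause_offset F ?k) = length (F ! ?k)"
    using w M enc_cnf_clause[OF k(1), of 0 n] by (auto simp: holds_list_def)
  have "Suc i < 2 ^ w"
    using 3 j w(2) clause_offset_ge[of "length F" F] by (simp add: length_enc_cnf)
  then show ?case
    using 3 w b o by (auto intro!: runs_Seq runs_assign simp: small_mod val_decr)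
qed (auto intro: Q)

lemma val_lit_true:
  assumes w: "3 \<le> w" and V: "V 18 = 2 * x + of_bool b"
  shows "val w V M lit_true = of_bool (x div V 2 = V 10 \<and> bit (V 11) (x mod V 2) = b)"
proof -
  have "V 18 div 2 = x" "V 18 mod 2 = of_bool b" using V by (cases b; simp)+
  moreover have "drop_bit k u mod 2 = of_bool (bit u k)" for u k :: nat
    by (cases "bit u k") (auto simp: bit_iff_odd_drop_bit even_iff_mod_2_eq_zero odd_iff_mod_2_eq_one)
  ultimately show ?thesis
    using w by (simp add: lit_true_def small_mod bool_mod)
qed

lemma lit_true_simps [simp]: "vars lit_true = {2, 10, 11, 18}" "cost lit_true = 21"
  by (auto simp: lit_true_def)

lemma runs_test_clause:
  assumes w: "3 \<le> w" "length (enc_cnf (n, F)) < 2 ^ w" and M: "holds_list M (enc_cnf (n, F))"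
    and j: "j < length F"
    and V: "V 14 = 1" "V 16 = clause_offset F j" "V 17 = length (F ! j)"
    and Q: "\<And>V' t'. V' 14 = of_bool (half_unsat (V 2) F (V 10) (V 11) j) \<Longrightarrow>
      \<forall>r. r \<notin> {14, 16, 17, 18} \<longrightarrow> V' r = V r \<Longrightarrow> t' \<le> t + 40 * length (F ! j) + 1 \<Longrightarrow> Q V' M t'"
  shows "runs w test_clause V M t Q"
proof -
  define L where "L = length (F ! j)"
  define lit where "lit l \<longleftrightarrow> fst (F ! j ! l) div V 2 = V 10 \<and>
    bit (V 11) (fst (F ! j ! l) mod V 2) = snd (F ! j ! l)" for l
  show ?thesis
    unfolding test_clause_def
  proof (rule runs_While[where n = L and I = "\<lambda>i V' M' t'. M' = M \<and> V' 17 = i \<and>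
      V' 16 = clause_offset F j + (L - i) \<and> V' 14 = of_bool (\<forall>l<L - i. \<not> lit l) \<and>
      (\<forall>r. r \<notin> {14, 16, 17, 18} \<longrightarrow> V' r = V r) \<and> t' + 40 * i \<le> t + 40 * L"], goal_cases)
    case 2
    then show ?case using V by (auto simp: L_def)
  next
    case (3 i V' M' t')
    let ?l = "L - Suc i"
    have l: "?l < L" "L - i = Suc ?l" using 3 by auto
    have "clause_offset F j + L < length (enc_cnf (n, F))"
      unfolding L_def by (rule clause_offset_less[OF j])
    then have b: "clause_offset F j + Suc ?l < 2 ^ w" "Suc i < 2 ^ w"
        "M (clause_offset F j + Suc ?l) = 2 * fst (F ! j ! ?l) + of_bool (snd (F ! j ! ?l))"
      using w M l enc_cnf_clause[OF j, of "Suc ?l" n] 3 by (auto simp: holds_list_def L_def)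
    have e: "val w U M lit_true = of_bool (lit ?l)"
      if "U 18 = 2 * fst (F ! j ! ?l) + of_bool (snd (F ! j ! ?l))" "U 2 = V 2" "U 10 = V 10" "U 11 = V 11" for U
      using val_lit_true[OF w(1), of U "fst (F ! j ! ?l)" "snd (F ! j ! ?l)"] that by (simp add: lit_def)
    have s: "(\<forall>l<L - i. \<not> lit l) \<longleftrightarrow> (\<forall>l<?l. \<not> lit l) \<and> \<not> lit ?l"
      unfolding l(2) by (auto simp: less_Suc_eq)
    have V': "V' 17 = Suc i" "V' 16 = clause_offset F j + ?l" "V' 14 = of_bool (\<forall>l<?l. \<not> lit l)"
      "V' 2 = V 2" "V' 10 = V 10" "V' 11 = V 11" "M' = M" using 3 by auto
    show ?case
      using 3 w b unfolding s
      by (auto intro!: runs_Seq runs_assign simp: small_mod bool_mod val_decr e V' l(2))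
  qed (auto intro!: Q simp: half_unsat_def j L_def lit_def)
qed

lemma runs_unsat_prog:
  assumes w: "3 \<le> w" "length (enc_cnf (n, F)) < 2 ^ w" and M: "holds_list M (enc_cnf (n, F))"
    and F: "(n, F) \<in> q_cnf q" and V: "V 1 = length F"
    and Q: "\<And>V' t'. V' 14 = of_bool (half_unsat (V 2) F (V 10) (V 11) (V 13)) \<Longrightarrow>
      \<forall>r. r \<notin> {14, 16, 17, 18} \<longrightarrow> V' r = V r \<Longrightarrow>
      t' \<le> t + 12 * length F + 40 * q + 20 \<Longrightarrow> Q V' M t'"
  shows "runs w unsat_prog V M t Q"
proof (cases "V 13 < length F")
  case False
  then have "half_unsat (V 2) F (V 10) (V 11) (V 13) = False" by (simp add: half_unsat_def)
  with False show ?thesis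
    unfolding unsat_prog_def
    by (auto intro!: runs_Seq runs_assign runs_If runs_Skip Q simp: V simp del: One_nat_def)
next
  case True
  have "length (F ! V 13) \<le> q" using F True by (auto simp: q_cnf_def)
  moreover have "M (clause_offset F (V 13)) = length (F ! V 13)"
    using M clause_offset_less[OF True, of n] enc_cnf_clause[OF True, of 0 n]
    by (auto simp: holds_list_def)
  ultimately show ?thesis
    unfolding unsat_prog_def using w True
    by (auto intro!: runs_Seq runs_assign runs_If Q runs_skip_clauses[OF w M True]
      runs_test_clause[OF w M True] simp: V small_mod bool_mod
      simp del: One_nat_def)
qed

section \<open>Computing a single text bit\<close>

text \<open>Registers: 1 number of clauses, 2 \<open>h\<close>, 3 \<open>d\<close>, 5 distance \<open>2r\<^sup>2\<close> of the marks, 6 \<open>zone d\<close>, 7 text length,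
  8 address of the buffer, 9 loop counter and position in the concatenated texts, 10 which text,
  11 vector, 12 position in the period, 13 clause, 14 value of \<open>half_unsat\<close>, 15 position in the code,
  19 the computed bit, 21 threshold for the answer.\<close>

definition coord_tail :: com where
  "coord_tail = Seq unsat_prog (IfNz 15
      (assign 19 (Bin Times (Reg 14) (Bin Equal (Bin Plus (Reg 10) (Num 1)) (Reg 15))))
      (assign 19 (Bin Equal (Reg 10) (Reg 14))))"

definition coord_prog :: com where
  "coord_prog = Seq (assign 13 (Bin Div (Reg 12) (Num 3)))
     (Seq (assign 15 (Bin Mod (Reg 12) (Num 3)))
     (Seq (assign 20 (Bin Less (Reg 13) (Reg 3)))
     (IfNz 20
       coord_tail
       (assign 19 (Num 0)))))"

definition bit_prog :: com where
  "bit_prog = Seq (assign 10 (Bin Div (Reg 9) (Reg 7)))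
     (Seq (assign 11 (Bin Div (Bin Mod (Reg 9) (Reg 7)) (Bin Times (Num 2) (Reg 6))))
     (Seq (assign 12 (Bin Mod (Bin Mod (Reg 9) (Reg 7)) (Bin Times (Num 2) (Reg 6))))
     (Seq (assign 20 (Bin Less (Reg 12) (Reg 6)))
     (IfNz 20
       (assign 19 (Bin Equal (Bin Mod (Reg 12) (Reg 5))
          (Bin Times (Bin Div (Reg 12) (Reg 5)) (Bin Div (Reg 12) (Reg 5)))))
       (Seq (assign 12 (Bin Minus (Reg 12) (Reg 6))) coord_prog)))))"

lemma runs_coord_prog:
  assumes w: "3 \<le> w" "length (enc_cnf (n, F)) < 2 ^ w"
    and M: "holds_list M (enc_cnf (n, F))" and F: "(n, F) \<in> q_cnf q"
    and V: "V 1 = length F" "V 10 < 2"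
    and Q: "\<And>V' t'. V' 19 = of_bool (V 12 div 3 < V 3 \<and>
        coord (V 10) (half_unsat (V 2) F (V 10) (V 11) (V 12 div 3)) (V 12 mod 3)) \<Longrightarrow>
      \<forall>r. r \<notin> {13..20} \<longrightarrow> V' r = V r \<Longrightarrow>
      t' \<le> t + 12 * length F + 40 * q + 60 \<Longrightarrow> Q V' M t'"
  shows "runs w coord_prog V M t Q"
proof (cases "V 12 div 3 < V 3")
  case False
  then show ?thesis
    unfolding coord_prog_def using w(1)
    by (auto intro!: runs_Seq runs_assign runs_If Q simp: small_mod bool_mod)
next
  case True
  define b where "b = half_unsat (V 2) F (V 10) (V 11) (V 12 div 3)"
  let ?V = "V(13 := V 12 div 3, 15 := V 12 mod 3, 20 := 1)"
  have tail: "runs w coord_tail ?V M t1 Q" if "t1 \<le> t + 13" for t1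
    unfolding coord_tail_def
  proof (rule runs_Seq, rule runs_unsat_prog[OF w M F])
    fix V' t'
    assume A: "V' 14 = of_bool (half_unsat (?V 2) F (?V 10) (?V 11) (?V 13))"
      and B: "\<forall>r. r \<notin> {14, 16, 17, 18} \<longrightarrow> V' r = ?V r"
      and t: "t' \<le> t1 + 12 * length F + 40 * q + 20"
    have R: "V' 14 = of_bool b" "V' 15 = V 12 mod 3" "V' 10 = V 10"
      using A B by (simp_all add: b_def)
    have keep: "(V'(19 := x)) r = V r" if "r \<notin> {13..20}" for x r
      using that B by auto
    have s: "Suc (V 10) mod 2 ^ w = Suc (V 10)" using V(2) w(1) by (simp add: small_mod)
    show "runs w (IfNz 15
          (assign 19 (Bin Times (Reg 14) (Bin Equal (Bin Plus (Reg 10) (Num 1)) (Reg 15))))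
          (assign 19 (Bin Equal (Reg 10) (Reg 14)))) V' M t' Q"
    proof (rule runs_If)
      assume "V' 15 \<noteq> 0"
      then have c: "V 12 mod 3 \<noteq> 0" using R by simp
      show "runs w (assign 19 (Bin Times (Reg 14) (Bin Equal (Bin Plus (Reg 10) (Num 1)) (Reg 15)))) V' M (t' + 1) Q"
      proof (rule runs_assign)
        show "Q (V'(19 := val w V' M (Bin Times (Reg 14) (Bin Equal (Bin Plus (Reg 10) (Num 1)) (Reg 15))))) M
            (t' + 1 + (cost (Bin Times (Reg 14) (Bin Equal (Bin Plus (Reg 10) (Num 1)) (Reg 15))) + 1))"
          using True c t that w(1) keep
          by (intro Q allI impI) (auto simp: R s b_def[symmetric] coord_def small_mod bool_mod)
      qed auto
    next
      assume "V' 15 = 0"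
      then have c: "V 12 mod 3 = 0" using R by simp
      show "runs w (assign 19 (Bin Equal (Reg 10) (Reg 14))) V' M (t' + 1) Q"
      proof (rule runs_assign)
        show "Q (V'(19 := val w V' M (Bin Equal (Reg 10) (Reg 14)))) M
            (t' + 1 + (cost (Bin Equal (Reg 10) (Reg 14)) + 1))"
          using True c t that w(1) keep
          by (intro Q allI impI) (auto simp: R b_def[symmetric] coord_def small_mod bool_mod)
      qed auto
    qed simp
  qed (use V in simp)
  show ?thesis
    unfolding coord_prog_def using w(1) True
    by (intro runs_Seq runs_assign runs_If) (simp_all add: small_mod bool_mod tail[unfolded One_nat_def])
qed

lemma runs_bit_prog:
  assumes w: "3 \<le> w" "length (enc_cnf (n, F)) < 2 ^ w" "2 * zone d < 2 ^ w"
    and M: "holds_list M (enc_cnf (n, F))" and F: "(n, F) \<in> q_cnf q" and d: "d > 0"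
    and V: "V 1 = length F" "V 3 = d" "V 5 = 2 * (8 * d) ^ 2" "V 6 = zone d" "V 9 < 2 * V 7"
    and Q: "\<And>V' t'. V' 19 = of_bool (text_bit d (half_unsat (V 2) F) (V 9 div V 7) (V 9 mod V 7)) \<Longrightarrow>
      \<forall>r. r \<notin> {10..20} \<longrightarrow> V' r = V r \<Longrightarrow>
      t' \<le> t + 12 * length F + 40 * q + 120 \<Longrightarrow> Q V' M t'"
  shows "runs w bit_prog V M t Q"
proof -
  define s where "s = V 9 div V 7"
  define u where "u = V 9 mod V 7 div (2 * zone d)"
  define y where "y = V 9 mod V 7 mod (2 * zone d)"
  define D where "D = zone d"
  define P where "P = 2 * (8 * d) ^ 2"
  have s: "s < 2" using V(5) by (simp add: s_def div_less_iff_less_mult mult.commute)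
  have tb: "text_bit d U s (V 9 mod V 7) \<longleftrightarrow>
      (if y < D then y mod P = y div P * (y div P)
       else (y - D) div 3 < d \<and> coord s (U s u ((y - D) div 3)) ((y - D) mod 3))" for U
    unfolding text_bit_def Let_def y_def u_def D_def P_def power2_eq_square ..
  \<comment> \<open>The square in the test for a mark must not wrap around. Within a zone the
    quotient is below \<open>8 * d\<close>, so its square is at most \<open>P\<close>.\<close>
  have sq: "y div P * (y div P) < 2 ^ w" if "y < D"
  proof -
    have "D = 8 * d * P" by (simp add: D_def P_def zone_def power2_eq_square power3_eq_cube)
    then have "y div P < 8 * d" using that by (simp add: less_mult_imp_div_less)
    then have "y div P * (y div P) \<le> 8 * d * (8 * d)" by (intro mult_mono) auto
    also have "\<dots> \<le> P" by (simp add: P_def power2_eq_square)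
    also have "P \<le> D" using \<open>D = 8 * d * P\<close> d by simp
    finally show ?thesis using w(3) by (simp add: D_def)
  qed
  have "zone d > 0" using d by (simp add: zone_def)
  then have "y < 2 * zone d" by (simp add: y_def)
  then have y: "y < 2 ^ w" using w(3) by linarith
  note Q' = Q[folded s_def, unfolded tb]
  have w3: "2 * D < 2 ^ w" using w(3) by (simp add: D_def)
  note V' = V(1-4)[folded D_def P_def]
  have u': "V 9 mod V 7 div (2 * D) = u" and y': "V 9 mod V 7 mod (2 * D) = y"
    by (simp_all add: u_def y_def D_def)
  show ?thesis
  proof (cases "y < D")
    case True
    then show ?thesis
      unfolding bit_prog_def using w(1) w3 sq s
      by (auto intro!: runs_Seq runs_assign runs_If Q' simp: V' u' y' s_def[symmetric] small_mod bool_mod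
        simp del: One_nat_def)
  next
    case False
    then show ?thesis
      unfolding bit_prog_def using w(1) w3 s y
      by (intro runs_Seq runs_assign runs_If runs_coord_prog[OF w(1,2) M F])
        (auto intro!: Q' simp: V' u' y' s_def[symmetric] small_mod bool_mod word_minus simp del: One_nat_def)
  qed
qed

section \<open>Writing the texts and arranging the memory\<close>

definition build_prog :: com where
  "build_prog = WhileNz 9 (Seq (assign 9 (decr 9))
     (Seq bit_prog (store (Bin Plus (Reg 8) (Reg 9)) (Reg 19))))"

lemma runs_build_prog:
  assumes w: "3 \<le> w" "length (enc_cnf (n, F)) \<le> B" "2 * zone d < 2 ^ w" "B + 2 * L < 2 ^ w"
    and M: "holds_list M (enc_cnf (n, F))" and F: "(n, F) \<in> q_cnf q" and d: "d > 0"
    and V: "V 1 = length F" "V 3 = d" "V 5 = 2 * (8 * d) ^ 2" "V 6 = zone d" "V 7 = L" "V 8 = B" "V 9 = 2 * L"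
    and Q: "\<And>V' t'. \<forall>r<9. V' r = V r \<Longrightarrow> t' \<le> t + 2 * L * (12 * length F + 40 * q + 140) + 1 \<Longrightarrow>
      Q V' (\<lambda>x. if B \<le> x \<and> x < B + 2 * L
        then of_bool (text_bit d (half_unsat (V 2) F) ((x - B) div L) ((x - B) mod L)) else M x) t'"
  shows "runs w build_prog V M t Q"
proof -
  define c where "c = 12 * length F + 40 * q + 140"
  define f where "f i = (of_bool (text_bit d (half_unsat (V 2) F) (i div L) (i mod L)) :: nat)" for i
  show ?thesis
    unfolding build_prog_def
  proof (rule runs_While[where n = "2 * L" and I = "\<lambda>i V' M' t'. V' 9 = i \<and> (\<forall>r<9. V' r = V r) \<and>
      M' = (\<lambda>x. if B + i \<le> x \<and> x < B + 2 * L then f (x - B) else M x) \<and>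
      t' + i * c \<le> t + 2 * L * c"], goal_cases)
    case 2
    then show ?case using V by auto
  next
    case (3 i V' M' t')
    then have V': "V' 9 = Suc i" "\<And>r. r < 9 \<Longrightarrow> V' r = V r" by auto
    \<comment> \<open>The formula is still intact, since it lies below the buffer, which starts at
      \<open>B\<close>.\<close>
    have M': "holds_list M' (enc_cnf (n, F))"
      using M w(2) 3 by (auto simp: holds_list_def)
    have le: "length (enc_cnf (n, F)) < 2 ^ w" "B + i < 2 ^ w" "Suc i < 2 ^ w" using w 3 by linarith+
    have upd: "M'(B + i := f i) = (\<lambda>x. if B + i \<le> x \<and> x < B + 2 * L then f (x - B) else M x)"
      using 3 by (intro ext) auto
    have "runs w (Seq bit_prog (store (Bin Plus (Reg 8) (Reg 9)) (Reg 19))) (V'(9 := i)) M' (5 + t')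
      (\<lambda>V' M' t'. V' 9 = i \<and> (\<forall>r<9. V' r = V r) \<and>
        M' = (\<lambda>x. if B + i \<le> x \<and> x < B + 2 * L then f (x - B) else M x) \<and> t' + i * c \<le> t + 2 * L * c)"
    proof (rule runs_Seq, rule runs_bit_prog[OF w(1) le(1) w(3) M' F d])
      fix V2 t2
      assume A: "V2 19 = of_bool (text_bit d (half_unsat ((V'(9 := i)) 2) F)
          ((V'(9 := i)) 9 div (V'(9 := i)) 7) ((V'(9 := i)) 9 mod (V'(9 := i)) 7))"
        and B: "\<forall>r. r \<notin> {10..20} \<longrightarrow> V2 r = (V'(9 := i)) r"
        and t: "t2 \<le> 5 + t' + 12 * length F + 40 * q + 120"
      have "V2 19 = f i" using A V' V by (simp add: f_def)
      moreover have "V2 8 = B" "V2 9 = i" "\<forall>r<9. V2 r = V r" using B V' V by auto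
      moreover have "t' + c + i * c \<le> t + 2 * L * c" using 3 by simp
      ultimately show "runs w (store (Bin Plus (Reg 8) (Reg 9)) (Reg 19)) V2 M' t2
        (\<lambda>V' M' t'. V' 9 = i \<and> (\<forall>r<9. V' r = V r) \<and>
        M' = (\<lambda>x. if B + i \<le> x \<and> x < B + 2 * L then f (x - B) else M x) \<and> t' + i * c \<le> t + 2 * L * c)"
        using le(2) t upd by (intro runs_store) (auto simp: c_def)
    qed (use V V' 3 in auto)
    then show ?case
      using V' le(3) by (intro conjI runs_Seq[of w "assign 9 (decr 9)"] runs_assign) (auto simp: val_decr)
  next
    case (4 V' M' t')
    have "M' = (\<lambda>x. if B \<le> x \<and> x < B + 2 * L then f (x - B) else M x)" using 4 by simp
    then show ?case using 4 Q[of V' "t' + 1"] unfolding f_def c_def by auto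
  qed simp
qed

text \<open>The LCS program has to find the texts from address 2 on and zeros behind them, so each
  buffer cell is cleared as soon as it has been copied.\<close>

definition copy_prog :: com where
  "copy_prog = WhileNz 9 (Seq (assign 9 (decr 9))
     (Seq (store (Bin Plus (Num 2) (Reg 9)) (Mem (Bin Plus (Reg 8) (Reg 9))))
       (store (Bin Plus (Reg 8) (Reg 9)) (Num 0))))"

lemma runs_copy_prog:
  assumes w: "3 \<le> w" "2 + 4 * L < 2 ^ w"
    and V: "V 8 = 2 + 2 * L" "V 9 = 2 * L"
    and M: "\<And>x. 2 + 2 * L \<le> x \<Longrightarrow> x < 2 + 4 * L \<Longrightarrow> M x = f (x - (2 + 2 * L))"
    and Q: "\<And>V' t'. \<forall>r<9. V' r = V r \<Longrightarrow> t' \<le> t + 2 * L * 30 + 1 \<Longrightarrow>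
      Q V' (\<lambda>x. if x < 2 \<or> 2 + 4 * L \<le> x then M x else if x < 2 + 2 * L then f (x - 2) else 0) t'"
  shows "runs w copy_prog V M t Q"
  unfolding copy_prog_def
proof (rule runs_While[where n = "2 * L" and I = "\<lambda>i V' M' t'. V' 9 = i \<and> (\<forall>r<9. V' r = V r) \<and>
    M' = (\<lambda>x. if 2 + i \<le> x \<and> x < 2 + 2 * L then f (x - 2)
      else if 2 + 2 * L + i \<le> x \<and> x < 2 + 4 * L then 0 else M x) \<and>
    t' + i * 30 \<le> t + 2 * L * 30"], goal_cases)
  case 2
  then show ?case using V by auto
next
  case (3 i V' M' t')
  then have V': "V' 9 = Suc i" "\<And>r. r < 9 \<Longrightarrow> V' r = V r" "V' 8 = 2 + 2 * L" using V by auto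
  have le: "2 + 2 * L + i < 2 ^ w" "2 + i < 2 ^ w" "Suc i < 2 ^ w" using w 3 by linarith+
  have ld: "M' (2 + 2 * L + i) = f i" using 3 M[of "2 + 2 * L + i"] by simp
  have upd: "M'(2 + i := f i, 2 + 2 * L + i := 0) = (\<lambda>x. if 2 + i \<le> x \<and> x < 2 + 2 * L then f (x - 2)
      else if 2 + 2 * L + i \<le> x \<and> x < 2 + 4 * L then 0 else M x)"
    using 3 by (intro ext) auto
  show ?case
    using V' le 3(1) w(1) upd ld
    by (intro conjI runs_Seq runs_assign runs_store) (auto simp: val_decr small_mod)
next
  case (4 V' M' t')
  have "M' = (\<lambda>x. if x < 2 \<or> 2 + 4 * L \<le> x then M x else if x < 2 + 2 * L then f (x - 2) else 0)"
    using 4 by (intro ext) auto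
  then show ?case using 4 Q[of V' "t' + 1"] by auto
qed simp

text \<open>\<open>K\<close> is built into the program. This is legitimate because it is chosen from
  \<open>C\<close> and \<open>q\<close> alone, not from the formula.\<close>

definition params_prog :: "nat \<Rightarrow> com" where
  "params_prog K = Seq (assign 0 (Mem (Num 0))) (Seq (assign 1 (Mem (Num 1)))
     (Seq (assign 2 (Bin Minus (Reg 0) (Bin Div (Reg 0) (Num 2))))
     (Seq (assign 3 (Bin Times (Num K) (Bin Plus (Bin Plus (Reg 1) (Reg 0)) (Num 1))))
     (Seq (assign 4 (Bin Times (Num 8) (Reg 3)))
     (Seq (assign 5 (Bin Times (Num 2) (Bin Times (Reg 4) (Reg 4))))
     (Seq (assign 6 (Bin Times (Reg 5) (Reg 4)))
     (Seq (assign 7 (Bin Times (Reg 6) (Bin Plus (Bin Times (Num 2) (Bin Shl (Num 1) (Reg 2))) (Num 1))))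
     (Seq (assign 8 (Bin Plus (Num 2) (Bin Times (Num 2) (Reg 7))))
       (assign 9 (Bin Times (Num 2) (Reg 7)))))))))))"

text \<open>Stating the value as a separate equation lets modular arithmetic be simplified away at
  each assignment, before the register contents enter the next one.\<close>

lemma runs_assign_Seq:
  assumes "val w V M e = v" "\<forall>r\<in>vars e. r < 32" "r < 32" "runs w c (V(r := v)) M (t + (cost e + 1)) Q"
  shows "runs w (Seq (assign r e) c) V M t Q"
  using assms by (intro runs_Seq runs_assign) auto

lemma runs_params_prog:
  assumes M: "M 0 = n" "M 1 = m" and K: "K > 0"
    and h: "h = n - n div 2" and d: "d = K * (m + n + 1)" and L: "L = zone d * (2 * 2 ^ h + 1)"
    and w: "8 * L + 8 < 2 ^ w"
    and Q: "\<And>V' t'. V' 1 = m \<Longrightarrow> V' 2 = h \<Longrightarrow> V' 3 = d \<Longrightarrow> V' 5 = 2 * (8 * d) ^ 2 \<Longrightarrow>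
      V' 6 = zone d \<Longrightarrow> V' 7 = L \<Longrightarrow> V' 8 = 2 + 2 * L \<Longrightarrow> V' 9 = 2 * L \<Longrightarrow> t' \<le> t + 70 \<Longrightarrow> Q V' M t'"
  shows "runs w (params_prog K) V M t Q"
proof -
  define r where "r = 8 * d"
  have dpos: "1 \<le> d" using K d by simp
  have z: "zone d = 2 * (r * r) * r" by (simp add: zone_def r_def power3_eq_cube)
  have "r \<le> r * r" using dpos by (simp add: r_def)
  have rz: "2 * (r * r) \<le> zone d" using dpos by (simp add: z r_def)
  have zL: "zone d \<le> L" by (simp add: L)
  have "1 \<le> zone d" using dpos by (simp add: zone_def)
  then have "1 * (2 * 2 ^ h + 1) \<le> L" unfolding L by (intro mult_right_mono) auto
  then have hL: "2 * 2 ^ h + 1 \<le> L" by simp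
  have "1 * (m + n + 1) \<le> d" unfolding d using K by (intro mult_right_mono) auto
  then have mn: "m + n + 1 \<le> d" by simp
  have "K * 1 \<le> d" unfolding d by (intro mult_left_mono) auto
  then have Kd: "K \<le> d" by simp
  have "d \<le> r" by (simp add: r_def)
  have W: "L < 2 ^ w" "2 + 2 * L < 2 ^ w" "zone d < 2 ^ w" "2 * (r * r) < 2 ^ w" "r * r < 2 ^ w"
    "r < 2 ^ w" "d < 2 ^ w" "K < 2 ^ w" "m + n + 1 < 2 ^ w" "2 * 2 ^ h + 1 < (2 ^ w :: nat)"
    "(2 ^ h :: nat) < 2 ^ w" "n < 2 ^ w" "2 * L < 2 ^ w"
    using w zL rz hL mn Kd \<open>d \<le> r\<close> \<open>r \<le> r * r\<close> by linarith+
  have w4: "3 < w"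
  proof (rule ccontr)
    assume "\<not> 3 < w"
    then have "(2::nat) ^ w \<le> 2 ^ 3" by (intro power_increasing) auto
    with w show False by simp
  qed
  \<comment> \<open>The constant 8 is just outside the range of \<open>small_mod\<close>.\<close>
  have w8: "8 mod 2 ^ w = (8::nat)"
    using w by (intro mod_less) linarith
  have s: "k mod 2 ^ w = (k::nat)" if "k < 8" for k using small_mod that w4 by simp
  have e1: "K * (Suc (m + n)) mod 2 ^ w = d" using W d by auto
  have e2: "nat ((int n - int (n div 2)) mod 2 ^ w) = h" using W h by (simp add: word_minus)
  have e3: "Suc (2 * 2 ^ h) mod 2 ^ w = 2 * 2 ^ h + 1" "zone d * (Suc (2 * 2 ^ h)) mod 2 ^ w = L"
    using mod_less[OF W(10)] mod_less[OF W(1)] L by simp_all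
  have e4: "Suc (m + n) mod 2 ^ w = Suc (m + n)" "(m + n) mod 2 ^ w = m + n" "K mod 2 ^ w = K"
    "(2 ^ h :: nat) mod 2 ^ w = 2 ^ h" "2 * 2 ^ h mod 2 ^ w = (2 * 2 ^ h :: nat)"
    using W by auto
  have e5: "8 * d mod 2 ^ w = r" "r * r mod 2 ^ w = r * r" "2 * (r * r) mod 2 ^ w = 2 * (r * r)"
    "2 * (r * r) * r mod 2 ^ w = zone d" "2 * L mod 2 ^ w = 2 * L"
    using W z by (auto simp: r_def)
  have e6: "Suc (Suc (2 * L)) mod 2 ^ w = 2 + 2 * L" using W by auto
  have s2: "2 mod 2 ^ w = (2::nat)" "Suc 0 mod 2 ^ w = Suc 0" "w > 0" using s w4 by auto
  have r2: "2 * (r * r) = 2 * (8 * d) ^ 2" by (simp add: r_def power2_eq_square)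
  show ?thesis
    unfolding params_prog_def
    apply (rule runs_assign_Seq[where v = n], (simp add: M; fail)+)
    apply (rule runs_assign_Seq[where v = m], (simp add: M[unfolded One_nat_def] s2; fail)+)
    apply (rule runs_assign_Seq[where v = h], (simp add: e2 s2; fail)+)
    apply (rule runs_assign_Seq[where v = d], (simp add: e1 e4 s2 del: mult_Suc_right; fail)+)
    apply (rule runs_assign_Seq[where v = r], (simp add: e5 w8; fail)+)
    apply (rule runs_assign_Seq[where v = "2 * (r * r)"], (simp add: e5 s2; fail)+)
    apply (rule runs_assign_Seq[where v = "zone d"], (use e5 in \<open>simp; fail\<close>)+)
    apply (rule runs_assign_Seq[where v = L], (simp add: e3 e4 s2 del: mult_Suc_right; fail)+)
    apply (rule runs_assign_Seq[where v = "2 + 2 * L"], (simp add: e5 e6 s2; fail)+)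
    apply (rule runs_assign, (simp; fail)+)
    apply (rule Q)
    apply (simp_all add: e5 s2 r2)
    done
qed

text \<open>The threshold is \<open>3 * zone d - 1\<close> because the final comparison,
  \<open>Less\<close>, is strict.\<close>

definition reduce_prog :: "nat \<Rightarrow> com" where
  "reduce_prog K = Seq (params_prog K) (Seq build_prog
     (Seq (assign 9 (Bin Times (Num 2) (Reg 7))) (Seq copy_prog
     (Seq (store (Num 0) (Reg 7)) (Seq (store (Num 1) (Reg 3))
       (assign 21 (Bin Minus (Bin Times (Num 3) (Reg 6)) (Num 1))))))))"

lemma memory_enc_lcs:
  assumes "L = zone d * (2 * N + 1)"
  shows "snd (init (enc_lcs (gadget_text N d U 0, gadget_text N d U 1, k))) =
    (\<lambda>x. if x = 0 then L else if x = 1 then k else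
      if x < 2 + 2 * L then of_bool (text_bit d U ((x - 2) div L) ((x - 2) mod L)) else 0)"
proof
  fix x
  let ?T = "gadget_text N d U"
  have len: "length (?T s) = L" for s by (simp add: length_gadget_text assms)
  have nth: "?T s ! i = text_bit d U s i" if "i < L" for s i
    using that assms by (simp add: gadget_text_def)
  consider "x = 0" | "x = 1" | "2 \<le> x" "x < 2 + L" | "2 + L \<le> x" "x < 2 + 2 * L" | "2 + 2 * L \<le> x"
    by linarith
  then show "snd (init (enc_lcs (?T 0, ?T 1, k))) x = (if x = 0 then L else if x = 1 then k else
      if x < 2 + 2 * L then of_bool (text_bit d U ((x - 2) div L) ((x - 2) mod L)) else 0)"
  proof cases
    case 3
    then obtain i where i: "x = Suc (Suc i)" "i < L" by (metis Suc_le_D add_2_eq_Suc add_less_cancel_left le_add_diff_inverse)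
    then show ?thesis by (simp add: init_def enc_lcs_def len nth_append nth)
  next
    case 4
    then obtain i where i: "x = Suc (Suc (L + i))" "i < L"
      by (metis add.assoc add_2_eq_Suc le_add_diff_inverse mult_2 nat_add_left_cancel_less)
    then show ?thesis by (simp add: init_def enc_lcs_def len nth_append nth div_add_self1)
  qed (auto simp: init_def enc_lcs_def len)
qed

lemma runs_reduce_prog:
  assumes F: "(n, F) \<in> q_cnf q" and K: "q + 1 \<le> K"
    and h: "h = n - n div 2" and d: "d = K * (length F + n + 1)" and L: "L = zone d * (2 * 2 ^ h + 1)"
    and w: "8 * L + 8 < 2 ^ w"
    and Q: "\<And>V' t'. V' 21 = 3 * zone d - 1 \<Longrightarrow> t' \<le> t + L * (24 * length F + 80 * q + 500) \<Longrightarrow>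
      Q V' (snd (init (enc_lcs (gadget_text (2 ^ h) d (half_unsat h F) 0, gadget_text (2 ^ h) d (half_unsat h F) 1, d)))) t'"
  shows "runs w (reduce_prog K) V (snd (init (enc_cnf (n, F)))) t Q"
proof -
  define M where "M = snd (init (enc_cnf (n, F)))"
  have dpos: "d > 0" using d K by simp
  have zL: "zone d \<le> L" by (simp add: L)
  have d1: "1 \<le> zone d" using dpos by (simp add: zone_def)
  have w3: "3 \<le> w"
  proof (rule ccontr)
    assume "\<not> 3 \<le> w"
    then have "(2::nat) ^ w \<le> 2 ^ 3" by (intro power_increasing) auto
    with w show False by simp
  qed
  \<comment> \<open>Here \<open>K\<close> has to exceed \<open>q\<close>: then \<open>d\<close>, and
    a fortiori a text, is at least as long as the list of all clauses, and the formula fits below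
    the buffer.\<close>
  have enc: "length (enc_cnf (n, F)) \<le> 2 + 2 * L"
  proof -
    have "(\<Sum>C\<leftarrow>F. Suc (length C)) \<le> (\<Sum>C\<leftarrow>F. q + 1)"
      using F by (intro sum_list_mono) (auto simp: q_cnf_def)
    also have "\<dots> \<le> d" using mult_mono[OF K, of "length F" "length F + n + 1"]
      by (simp add: sum_list_triv d mult.commute)
    also have "\<dots> \<le> zone d" using zone_ge[of d] by simp
    finally show ?thesis using zL by (simp add: length_enc_cnf clause_offset_def)
  qed
  have M: "M 0 = n" "M 1 = length F" "holds_list M (enc_cnf (n, F))"
    and M0: "\<And>x. length (enc_cnf (n, F)) \<le> x \<Longrightarrow> M x = 0"
    by (auto simp: M_def init_def holds_list_def enc_cnf_def)
  define f where "f i = (of_bool (text_bit d (half_unsat h F) (i div L) (i mod L)) :: nat)" for i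
  have W: "3 * zone d < 2 ^ w" "2 * zone d < 2 ^ w" "2 * L < 2 ^ w" "2 + 4 * L < 2 ^ w" "2 + 2 * L + 2 * L < 2 ^ w"
    using w zL by linarith+
  have tm: "t + 70 + (2 * L * (12 * length F + 40 * q + 140) + 1) + 4 + (2 * L * 30 + 1) + 20
      \<le> t + L * (24 * length F + 80 * q + 500)"
    using d1 zL by (simp add: algebra_simps)
  show ?thesis
    unfolding M_def[symmetric] reduce_prog_def
  proof (rule runs_Seq, rule runs_params_prog[OF M(1,2) _ h d L w])
    fix V1 :: "nat \<Rightarrow> nat" and t1 :: nat
    assume V1: "V1 1 = length F" "V1 2 = h" "V1 3 = d" "V1 5 = 2 * (8 * d) ^ 2"
      "V1 6 = zone d" "V1 7 = L" "V1 8 = 2 + 2 * L" "V1 9 = 2 * L" and t1: "t1 \<le> t + 70"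
    show "runs w (Seq build_prog
     (Seq (assign 9 (Bin Times (Num 2) (Reg 7))) (Seq copy_prog
     (Seq (store (Num 0) (Reg 7)) (Seq (store (Num 1) (Reg 3))
       (assign 21 (Bin Minus (Bin Times (Num 3) (Reg 6)) (Num 1)))))))) V1 M t1 Q"
    proof (rule runs_Seq, rule runs_build_prog[OF w3 enc W(2) W(5) M(3) F dpos V1(1,3-8)])
      fix V2 :: "nat \<Rightarrow> nat" and t2 :: nat
      assume V2: "\<forall>r<9. V2 r = V1 r" and t2: "t2 \<le> t1 + 2 * L * (12 * length F + 40 * q + 140) + 1"
      let ?M2 = "\<lambda>x. if 2 + 2 * L \<le> x \<and> x < 2 + 2 * L + 2 * L then of_bool
        (text_bit d (half_unsat (V1 2) F) ((x - (2 + 2 * L)) div L) ((x - (2 + 2 * L)) mod L)) else M x"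
      have R: "V2 7 = L" "V2 8 = 2 + 2 * L" using V2 V1 by auto
      have copy: "runs w copy_prog (V2(9 := 2 * L)) ?M2 t4 (\<lambda>V M t. runs w
        (Seq (store (Num 0) (Reg 7)) (Seq (store (Num 1) (Reg 3))
          (assign 21 (Bin Minus (Bin Times (Num 3) (Reg 6)) (Num 1))))) V M t Q)"
        if "t4 \<le> t2 + 4" for t4
      proof (rule runs_copy_prog[OF w3 W(4), where f = f])
        fix V3 :: "nat \<Rightarrow> nat" and t3 :: nat
        assume V3: "\<forall>r<9. V3 r = (V2(9 := 2 * L)) r" and t3: "t3 \<le> t4 + 2 * L * 30 + 1"
        let ?M3 = "\<lambda>x. if x < 2 \<or> 2 + 4 * L \<le> x then ?M2 x else if x < 2 + 2 * L then f (x - 2) else 0"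
        have R: "V3 3 = d" "V3 6 = zone d" "V3 7 = L" using V1 V2 V3 by auto
        have "?M3(0 := L, 1 := d) = snd (init (enc_lcs
          (gadget_text (2 ^ h) d (half_unsat h F) 0, gadget_text (2 ^ h) d (half_unsat h F) 1, d)))"
          unfolding memory_enc_lcs[OF L] using M0 enc by (intro ext) (auto simp: f_def)
        moreover have "val w V3 M' (Bin Minus (Bin Times (Num 3) (Reg 6)) (Num 1)) = 3 * zone d - 1" for M'
          using W(1) w3 d1 word_minus[of 1 "3 * zone d" w] by (simp add: R small_mod)
        moreover have fin: "Q (V3(21 := 3 * zone d - 1)) (snd (init (enc_lcs
          (gadget_text (2 ^ h) d (half_unsat h F) 0, gadget_text (2 ^ h) d (half_unsat h F) 1, d)))) t5"
          if "t5 \<le> t3 + 12" for t5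
          using t1 t2 t3 \<open>t4 \<le> t2 + 4\<close> tm that by (intro Q) auto
        ultimately show "runs w (Seq (store (Num 0) (Reg 7)) (Seq (store (Num 1) (Reg 3))
            (assign 21 (Bin Minus (Bin Times (Num 3) (Reg 6)) (Num 1))))) V3 ?M3 t3 Q"
          using fin w3
          by (intro runs_Seq runs_assign runs_store) (auto simp: R small_mod simp del: fun_upd_apply)
      qed (use R in \<open>auto simp: f_def V1(2)\<close>)
      show "runs w (Seq (assign 9 (Bin Times (Num 2) (Reg 7))) (Seq copy_prog
         (Seq (store (Num 0) (Reg 7)) (Seq (store (Num 1) (Reg 3))
           (assign 21 (Bin Minus (Bin Times (Num 3) (Reg 6)) (Num 1)))))))  V2 ?M2 t2 Q"
        using R W(3) w3 copy
        by (intro runs_Seq[of w "assign 9 (Bin Times (Num 2) (Reg 7))"] runs_assign runs_Seq[of w copy_prog])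
          (auto simp: small_mod)
    qed
  qed (use K in auto)
qed

section \<open>Running time\<close>

text \<open>Renaming moves the registers of the reduction out of the way of \<open>p\<close>, which must start with
  zero registers; the threshold then survives the run of \<open>p\<close> in register \<open>b + 21\<close>.\<close>

definition sat_prog :: "nat \<Rightarrow> nat \<Rightarrow> com \<Rightarrow> com" where
  "sat_prog b K p = Seq (rename (\<lambda>r. b + r) (reduce_prog K)) (Seq p (Op 0 Less (b + 21) 0))"

lemma exec_sat_prog:
  assumes F: "(n, F) \<in> q_cnf q" and K: "q + 1 \<le> K"
    and h: "h = n - n div 2" and d: "d = K * (length F + n + 1)" and L: "L = zone d * (2 * 2 ^ h + 1)"
    and w: "8 * L + 8 < 2 ^ w"
    and b: "regs p \<subseteq> {..<b}" "0 < b"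
    and x: "x = (gadget_text (2 ^ h) d (half_unsat h F) 0, gadget_text (2 ^ h) d (half_unsat h F) 1, d)"
    and p: "exec w p (init (enc_lcs x)) tp (R, M)" "lcs_spec x R"
  shows "\<exists>t R' M'. exec w (sat_prog b K p) (init (enc_cnf (n, F))) t (R', M') \<and>
    t \<le> L * (24 * length F + 80 * q + 500) + tp + 1 \<and> sat_spec (n, F) R'"
proof -
  have fst_init: "fst (init xs) = (\<lambda>_. 0)" for xs by (simp add: init_def)
  have pair_init: "init xs = ((\<lambda>_. 0), snd (init xs))" for xs by (simp add: init_def)
  have "runs w (reduce_prog K) (\<lambda>_. 0) (snd (init (enc_cnf (n, F)))) 0
      (\<lambda>V M t. V 21 = 3 * zone d - 1 \<and> M = snd (init (enc_lcs x)) \<and>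
        t \<le> L * (24 * length F + 80 * q + 500))"
    by (rule runs_reduce_prog[OF F K h d L w]) (auto simp: x)
  then obtain t1 R1 where 1: "exec w (reduce_prog K) ((\<lambda>_. 0), snd (init (enc_cnf (n, F)))) t1 (R1, snd (init (enc_lcs x)))"
      "R1 21 = 3 * zone d - 1" "t1 \<le> L * (24 * length F + 80 * q + 500)"
    unfolding runs_def by force
  from exec_rename[OF 1(1), of "\<lambda>r. b + r" UNIV "\<lambda>_. 0"] obtain S1 where
    S1: "exec w (rename (\<lambda>r. b + r) (reduce_prog K)) ((\<lambda>_. 0), snd (init (enc_cnf (n, F)))) t1 (S1, snd (init (enc_lcs x)))"
      "\<And>r. S1 (b + r) = R1 r" "\<And>r. r \<notin> range (\<lambda>r. b + r) \<Longrightarrow> S1 r = 0"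
    by (auto simp: inj_def)
  \<comment> \<open>The shifted reduction does not touch these registers, so \<open>p\<close> finds
    them as \<open>init\<close> demands.\<close>
  have "S1 r = 0" if "r < b" for r using that by (intro S1(3)) auto
  then have "\<forall>r\<in>{..<b}. S1 r = fst (init (enc_lcs x)) r" by (simp add: fst_init)
  from exec_rename[OF p(1), of "\<lambda>r. r", OF _ b(1) this] obtain S2 where
    S2: "exec w p (S1, snd (init (enc_lcs x))) tp (S2, M)" "\<forall>r<b. S2 r = R r" "\<forall>r. b \<le> r \<longrightarrow> S2 r = S1 r"
    by (auto simp: rename_ident)
  let ?R = "S2(0 := eval_binop w Less (S2 (b + 21)) (S2 0))"
  have "exec w (sat_prog b K p) ((\<lambda>_. 0), snd (init (enc_cnf (n, F)))) (t1 + (tp + 1)) (?R, M)"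
    unfolding sat_prog_def by (intro exec.Seq[OF S1(1)] exec.Seq[OF S2(1)] exec.Op)
  then have "exec w (sat_prog b K p) (init (enc_cnf (n, F))) (t1 + (tp + 1)) (?R, M)"
    by (metis pair_init)
  moreover have "sat_spec (n, F) ?R"
  proof -
    have w0: "0 < w" using w by (cases w) auto
    have dpos: "0 < d" using d K by simp
    have dl: "length F \<le> d" using mult_mono[of 1 K "length F" "length F + n + 1"] K d by simp
    have S: "S2 0 = R 0" "S2 (b + 21) = 3 * zone d - 1"
      using S2 b(2) S1(2) 1(2) by auto
    have "R 1 + R 0 \<le> L" "R 2 + R 0 \<le> L"
      "longest_common_k d (gadget_text (2 ^ h) d (half_unsat h F) 0) (gadget_text (2 ^ h) d (half_unsat h F) 1)
        (take (R 0) (drop (R 1) (gadget_text (2 ^ h) d (half_unsat h F) 0)))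
        (take (R 0) (drop (R 2) (gadget_text (2 ^ h) d (half_unsat h F) 1)))"
      using p(2) by (simp_all add: lcs_spec_def x length_gadget_text L)
    from gadget_text_longest_iff[OF dpos L this]
    have "3 * zone d \<le> R 0 \<longleftrightarrow> satisfiable (n, F)"
      unfolding satisfiable_iff_halves[OF F dl h] .
    moreover have "0 < zone d" using dpos by (simp add: zone_def)
    ultimately show ?thesis using w0 by (auto simp: sat_spec_def S)
  qed
  ultimately show ?thesis using 1(3) by (intro exI[of _ "t1 + (tp + 1)"] exI[of _ ?R] exI[of _ M]) auto
qed

section \<open>Estimates for the running time and the padding\<close>

lemma bigo_powr_bound:
  fixes T :: "nat \<Rightarrow> nat"
  assumes T: "(\<lambda>n. real (T n)) \<in> O(\<lambda>n. real n powr (2 - \<epsilon>))" and e: "e \<le> \<epsilon>" "e \<le> 2"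
  obtains c where "c > 0" "\<And>n. n \<ge> 1 \<Longrightarrow> real (T n) \<le> c * real n powr (2 - e)"
proof -
  from T obtain c0 where c0: "c0 > 0" "eventually (\<lambda>n. norm (real (T n)) \<le> c0 * norm (real n powr (2 - \<epsilon>))) at_top"
    by (elim landau_o.bigE)
  then obtain N where N: "\<And>n. n \<ge> N \<Longrightarrow> real (T n) \<le> c0 * real n powr (2 - \<epsilon>)"
    by (auto simp: eventually_at_top_linorder)
  \<comment> \<open>Adding all of the finitely many early values turns the asymptotic bound into one
    for every \<open>n \<ge> 1\<close>; this works because \<open>real n powr (2 - e)\<close> is at
    least 1 there.\<close>
  define c where "c = c0 + (\<Sum>n<N. real (T n))"
  have S: "0 \<le> (\<Sum>n<N. real (T n))" by (simp add: sum_nonneg)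
  show thesis
  proof
    show "c > 0" using c0(1) S by (simp add: c_def)
    fix n :: nat assume n: "n \<ge> 1"
    show "real (T n) \<le> c * real n powr (2 - e)"
    proof (cases "n < N")
      case True
      then have "real (T n) \<le> (\<Sum>n<N. real (T n))" by (intro member_le_sum) auto
      also have "\<dots> \<le> c * 1" using c0(1) by (simp add: c_def)
      also have "\<dots> \<le> c * real n powr (2 - e)"
        using n e \<open>c > 0\<close> by (intro mult_left_mono ge_one_powr_ge_zero) auto
      finally show ?thesis .
    next
      case False
      then have "real (T n) \<le> c0 * real n powr (2 - \<epsilon>)" by (intro N) auto
      also have "\<dots> \<le> c * real n powr (2 - e)"
        using n e c0(1) S by (intro mult_mono powr_mono) (auto simp: c_def)
      finally show ?thesis .
    qed
  qed
qed

lemma poly_le_exp: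
  assumes "a > (0::real)"
  obtains c where "c > 0" "\<And>n::nat. (real n + 1) ^ k \<le> c * 2 powr (a * real n)"
proof -
  have "(\<lambda>n::nat. (real n + 1) ^ k / 2 powr (a * real n)) \<longlonglongrightarrow> 0"
    using assms by real_asymp
  then have "Bseq (\<lambda>n::nat. (real n + 1) ^ k / 2 powr (a * real n))"
    by (intro convergent_imp_Bseq) (auto simp: convergent_def)
  then obtain c where "c > 0" "\<And>n. norm ((real n + 1) ^ k / 2 powr (a * real n)) \<le> c"
    by (auto simp: Bseq_def)
  then show thesis by (intro that[of c]) (auto simp: field_simps)
qed

lemma text_length_le:
  assumes "d = K * x" "L = zone d * (2 * 2 ^ h + 1)"
  shows "real L \<le> 4096 * real K ^ 3 * real x ^ 3 * 2 ^ h"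
proof -
  \<comment> \<open>The constant is \<open>4096 = 2 * 8 ^ 3 * 4\<close>, where 4 comes from bounding
    \<open>2 * 2 ^ h + 1\<close>.\<close>
  have "L \<le> zone d * (4 * 2 ^ h)" unfolding assms(2) by (intro mult_left_mono) auto
  also have "zone d * (4 * 2 ^ h) = 4096 * K ^ 3 * x ^ 3 * 2 ^ h"
    by (simp add: zone_def assms(1) power_mult_distrib)
  finally have "real L \<le> real (4096 * K ^ 3 * x ^ 3 * 2 ^ h)" by (simp only: of_nat_le_iff)
  then show ?thesis by simp
qed

text \<open>Coordinates beyond the number of clauses are 0; they serve to make \<open>d\<close>, and with it the number of
  mismatches, at least \<open>C * log L\<close>.\<close>

lemma ex_padding:
  assumes C: "C > 0"
  obtains K where "K \<ge> q" "K > 0" "\<And>x h d L. x \<ge> 1 \<Longrightarrow> h \<le> x \<Longrightarrow> d = K * x \<Longrightarrow>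
    L = zone d * (2 * 2 ^ h + 1) \<Longrightarrow> C * log 2 (real L) \<le> real d"
proof -
  \<comment> \<open>The 16 is \<open>12 + 3 + 1\<close>: the logarithm of 4096, the bound
    \<open>3 * x\<close> for the logarithm of \<open>x ^ 3\<close>, and \<open>h \<le> x\<close>. As
    \<open>K\<close> enters the left-hand side only through its logarithm, a large \<open>K\<close>
    wins.\<close>
  have "eventually (\<lambda>K::real. C * (16 + 3 * log 2 K) \<le> K) at_top"
    using C by real_asymp
  then have "eventually (\<lambda>K::nat. C * (16 + 3 * log 2 (real K)) \<le> real K) at_top"
    by (rule eventually_compose_filterlim) (rule filterlim_real_sequentially)
  then obtain K0 where K0: "\<And>K. K \<ge> K0 \<Longrightarrow> C * (16 + 3 * log 2 (real K)) \<le> real K"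
    by (auto simp: eventually_at_top_linorder)
  define K where "K = max K0 (max q 1)"
  have K: "C * (16 + 3 * log 2 (real K)) \<le> real K" "K \<ge> q" "K > 0"
    using K0[of K] by (auto simp: K_def)
  show thesis
  proof (rule that[OF K(2,3)])
    fix x h d L :: nat
    assume x: "x \<ge> 1" "h \<le> x" and d: "d = K * x" and L: "L = zone d * (2 * 2 ^ h + 1)"
    have "0 < zone d" using d x K(3) by (simp add: zone_def)
    then have Lpos: "real L > 0" unfolding L of_nat_0_less_iff by (intro mult_pos_pos) auto
    have "log 2 (real L) \<le> log 2 (4096 * real K ^ 3 * real x ^ 3 * 2 ^ h)"
      using text_length_le[OF d L] Lpos by (intro log_mono) auto
    also have "\<dots> = log 2 4096 + 3 * log 2 (real K) + 3 * log 2 (real x) + real h"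
      using K(3) x by (simp add: log_mult log_nat_power)
    also have "log 2 4096 = (12::real)" using log_pow_cancel[of 2 12] by simp
    also have "12 + 3 * log 2 (real K) + 3 * log 2 (real x) + real h \<le> real x * (16 + 3 * log 2 (real K))"
    proof -
      have "log 2 (real x) \<le> real x"
      proof -
        have "real x \<le> 2 ^ x" by (metis less_exp less_imp_le of_nat_le_iff of_nat_numeral of_nat_power)
        then have "log 2 (real x) \<le> log 2 (2 ^ x)" using x by (intro log_mono) auto
        then show ?thesis by simp
      qed
      moreover have "0 \<le> log 2 (real K)" using K(3) by simp
      then have "1 * (3 * log 2 (real K)) \<le> real x * (3 * log 2 (real K))"
        using x by (intro mult_right_mono) auto
      moreover have "real h \<le> real x" "1 \<le> real x" using x by auto
      ultimately show ?thesis by (simp add: algebra_simps)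
    qed
    finally have "C * log 2 (real L) \<le> C * (real x * (16 + 3 * log 2 (real K)))"
      using C by simp
    also have "\<dots> = real x * (C * (16 + 3 * log 2 (real K)))" by simp
    also have "\<dots> \<le> real x * real K" using K(1) by (intro mult_left_mono) auto
    finally show "C * log 2 (real L) \<le> real d" by (simp add: d mult.commute)
  qed
qed

text \<open>The exponent 7 of \<open>m + 1\<close> arises as 6 from the square of a cubic zone
  length and 1 from the linear time spent on each text bit.\<close>

lemma reduction_time_bound:
  fixes T :: "nat \<Rightarrow> nat"
  assumes e: "0 < e" "e \<le> 1" and c: "c > 0" "\<And>n. n \<ge> 1 \<Longrightarrow> real (T n) \<le> c * real n powr (2 - e)"
    and K: "K > 0"
  obtains c' :: nat where "\<And>n m h d L. h = n - n div 2 \<Longrightarrow> d = K * (m + n + 1) \<Longrightarrow>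
    L = zone d * (2 * 2 ^ h + 1) \<Longrightarrow>
    real (L * (24 * m + c1) + T L) \<le> real (c' * (m + 1) ^ 7) * 2 powr ((1 - e / 4) * real n)"
proof -
  obtain c3 where c3: "c3 > 0" "\<And>n::nat. (real n + 1) ^ 6 \<le> c3 * 2 powr (e / 4 * real n)"
    using poly_le_exp[of "e / 4"] e by auto
  define c4 where "c4 = (24 + real c1 + c) * ((4096 * real K ^ 3) ^ 2 * 2 * c3)"
  define c' where "c' = nat \<lceil>c4\<rceil>"
  have c': "c4 \<le> real c'" unfolding c'_def by (rule real_nat_ceiling_ge)
  show thesis
  proof (rule that[of c'])
    fix n m h d L :: nat
    assume h: "h = n - n div 2" and d: "d = K * (m + n + 1)" and L: "L = zone d * (2 * 2 ^ h + 1)"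
    have "1 \<le> L" using K by (simp add: L d zone_def Suc_le_eq)
    define P where "P = real L powr (2 - e)"
    \<comment> \<open>Here \<open>e \<le> 1\<close> matters: writing down the texts takes time
      linear in \<open>L\<close>, which must not exceed \<open>L powr (2 - e)\<close>.\<close>
    have LP: "real L \<le> P"
      using powr_mono[of 1 "2 - e" "real L"] \<open>1 \<le> L\<close> e by (simp add: P_def)
    define A where "A = 4096 * real K ^ 3 * real (m + n + 1) ^ 3"
    have A1: "1 \<le> A"
    proof -
      have "1 \<le> real K ^ 3" "1 \<le> real (m + n + 1) ^ 3" using K by (simp_all add: one_le_power)
      then have "1 * 1 \<le> real K ^ 3 * real (m + n + 1) ^ 3" by (intro mult_mono) auto
      then show ?thesis by (simp add: A_def)
    qed
    have "P \<le> (A * 2 ^ h) powr (2 - e)"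
      unfolding P_def A_def using text_length_le[OF d L] e by (intro powr_mono2) auto
    also have "\<dots> = A powr (2 - e) * 2 powr (real h * (2 - e))"
      using A1 by (simp add: powr_mult powr_powr powr_realpow[symmetric])
    also have "\<dots> \<le> A ^ 2 * (2 * 2 powr ((1 - e / 2) * real n))"
    proof (rule mult_mono)
      show "A powr (2 - e) \<le> A ^ 2"
        using powr_mono[of "2 - e" 2 A] A1 e by simp
      \<comment> \<open>Rounding \<open>n / 2\<close> up costs at most a factor 2.\<close>
      have "real h \<le> (real n + 1) / 2" by (simp add: h)
      then have "real h * (2 - e) \<le> (real n + 1) / 2 * (2 - e)" using e by (intro mult_right_mono) auto
      also have "\<dots> \<le> 1 + (1 - e / 2) * real n" using e by (simp add: field_simps)
      finally have "2 powr (real h * (2 - e)) \<le> 2 powr (1 + (1 - e / 2) * real n)" by simp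
      then show "2 powr (real h * (2 - e)) \<le> 2 * 2 powr ((1 - e / 2) * real n)" by (simp add: powr_add)
    qed (use A1 in auto)
    also have "A ^ 2 \<le> (4096 * real K ^ 3) ^ 2 * ((real m + 1) ^ 6 * (c3 * 2 powr (e / 4 * real n)))"
    proof -
      \<comment> \<open>Passing to the product separates \<open>m\<close>, which may stay
        polynomial, from \<open>n\<close>, which has to go into the exponential.\<close>
      have "real (m + n + 1) ^ 6 \<le> ((real m + 1) * (real n + 1)) ^ 6"
        by (intro power_mono) (auto simp: algebra_simps)
      also have "\<dots> = (real m + 1) ^ 6 * (real n + 1) ^ 6" by (rule power_mult_distrib)
      also have "\<dots> \<le> (real m + 1) ^ 6 * (c3 * 2 powr (e / 4 * real n))"
        using c3(2) by (intro mult_left_mono) auto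
      finally have x6: "real (m + n + 1) ^ 6 \<le> (real m + 1) ^ 6 * (c3 * 2 powr (e / 4 * real n))" .
      have "A ^ 2 = (4096 * real K ^ 3) ^ 2 * real (m + n + 1) ^ 6"
        by (simp add: A_def power_mult_distrib power_mult[symmetric])
      then show ?thesis using x6 by (simp only:) (rule mult_left_mono, auto)
    qed
    finally have "P \<le> (4096 * real K ^ 3) ^ 2 * ((real m + 1) ^ 6 * (c3 * 2 powr (e / 4 * real n))) *
        (2 * 2 powr ((1 - e / 2) * real n))" by simp
    also have "\<dots> = ((4096 * real K ^ 3) ^ 2 * 2 * c3) * (real m + 1) ^ 6 *
        (2 powr (e / 4 * real n) * 2 powr ((1 - e / 2) * real n))" by (simp add: mult_ac)
    also have "2 powr (e / 4 * real n) * 2 powr ((1 - e / 2) * real n) = 2 powr ((1 - e / 4) * real n)"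
      by (simp add: powr_add[symmetric] algebra_simps)
    finally have P: "P \<le> ((4096 * real K ^ 3) ^ 2 * 2 * c3) * (real m + 1) ^ 6 * 2 powr ((1 - e / 4) * real n)" .
    have "real (L * (24 * m + c1) + T L) \<le> P * (24 * real m + real c1) + c * P"
    proof -
      have "real L * (24 * real m + real c1) \<le> P * (24 * real m + real c1)"
        using LP by (intro mult_right_mono) auto
      then show ?thesis using c(2)[OF \<open>1 \<le> L\<close>] by (simp add: P_def)
    qed
    also have "\<dots> \<le> (24 + real c1 + c) * (real m + 1) * P"
    proof -
      have "0 \<le> P" by (simp add: P_def)
      moreover have "24 * real m + real c1 + c \<le> (24 + real c1 + c) * (real m + 1)"
        using c(1) by (simp add: algebra_simps)
      ultimately have "(24 * real m + real c1 + c) * P \<le> (24 + real c1 + c) * (real m + 1) * P"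
        by (intro mult_right_mono)
      then show ?thesis by (simp add: algebra_simps)
    qed
    also have "\<dots> \<le> (24 + real c1 + c) * (real m + 1) *
        (((4096 * real K ^ 3) ^ 2 * 2 * c3) * (real m + 1) ^ 6 * 2 powr ((1 - e / 4) * real n))"
      using P c(1) by (intro mult_left_mono) auto
    also have "\<dots> = c4 * (real m + 1) ^ 7 * 2 powr ((1 - e / 4) * real n)"
      by (simp add: c4_def power_eq_if[of _ 7] mult_ac)
    also have "\<dots> \<le> real c' * (real m + 1) ^ 7 * 2 powr ((1 - e / 4) * real n)"
      using c' by (intro mult_right_mono) auto
    finally show "real (L * (24 * m + c1) + T L) \<le> real (c' * (m + 1) ^ 7) * 2 powr ((1 - e / 4) * real n)"
      by (simp add: add.commute)
  qed
qed

section \<open>Assembling the reduction\<close>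

lemma enc_lcs_gadget:
  assumes "L = zone d * (2 * N + 1)"
  shows "length (enc_lcs (gadget_text N d U 0, gadget_text N d U 1, k)) = 2 + 2 * L"
    "set (enc_lcs (gadget_text N d U 0, gadget_text N d U 1, k)) \<subseteq> {L, k, 0, 1}"
  by (auto simp: enc_lcs_def length_gadget_text assms of_bool_def)

theorem theorem1:
  assumes "\<exists>\<epsilon>::real. \<epsilon> > 0 \<and>
    (\<exists>(C::real) p (T :: nat \<Rightarrow> nat). C > 0 \<and>
      (\<lambda>n. real (T n)) \<in> O(\<lambda>n. real n powr (2 - \<epsilon>)) \<and>
      solves_in_time p enc_lcs (lcs_instances C) lcs_spec
        (\<lambda>(T1, T2, k). real (T (length T1))))"
  shows "\<not> SETH"
proof -
  from assms obtain \<epsilon> C :: real and p and T :: "nat \<Rightarrow> nat" where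
    eps: "\<epsilon> > 0" and C: "C > 0" and T: "(\<lambda>n. real (T n)) \<in> O(\<lambda>n. real n powr (2 - \<epsilon>))"
    and p: "solves_in_time p enc_lcs (lcs_instances C) lcs_spec (\<lambda>(T1, T2, k). real (T (length T1)))"
    by blast
  from p obtain a :: nat where "\<forall>x\<in>lcs_instances C. \<forall>w. (\<forall>v\<in>set (enc_lcs x). v < 2 ^ w) \<and>
      real w \<ge> real a * log 2 (real (length (enc_lcs x)) + real (T (length (fst x)))) \<longrightarrow>
      (\<exists>t R M. exec w p (init (enc_lcs x)) t (R, M) \<and> real t \<le> real (T (length (fst x))) \<and> lcs_spec x R)"
    unfolding solves_in_time_def case_prod_beta by blast
  note a = this[rule_format, OF _ conjI]
  define e where "e = min \<epsilon> 1"
  have e: "0 < e" "e \<le> 1" "e \<le> \<epsilon>" using eps by (auto simp: e_def)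
  obtain c where c: "c > 0" "\<And>n. n \<ge> 1 \<Longrightarrow> real (T n) \<le> c * real n powr (2 - e)"
    using bigo_powr_bound[OF T e(3)] e(2) by auto
  define b where "b = Suc (Max (insert 0 (regs p)))"
  have b: "regs p \<subseteq> {..<b}" "0 < b"
    using finite_regs[of p] by (auto simp: b_def less_Suc_eq_le)
  \<comment> \<open>Refuting \<open>SETH\<close> takes a single saving that works for all
    \<open>q\<close>. It is \<open>e / 4\<close>; only \<open>K\<close> and the factor
    \<open>f\<close> vary with \<open>q\<close>.\<close>
  have "\<exists>p' (f :: nat \<Rightarrow> nat) l :: nat. (\<lambda>m. real (f m)) \<in> O(\<lambda>m. real m ^ l) \<and>
     solves_in_time p' enc_cnf (q_cnf q) sat_spec
       (\<lambda>(n, F). real (f (length F)) * 2 powr ((1 - e / 4) * real n))" for q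
  proof -
    obtain K where K: "K \<ge> q + 1" "K > 0" and pad: "\<And>x h d L. x \<ge> 1 \<Longrightarrow> h \<le> x \<Longrightarrow> d = K * x \<Longrightarrow>
        L = zone d * (2 * 2 ^ h + 1) \<Longrightarrow> C * log 2 (real L) \<le> real d"
      using ex_padding[OF C, of "q + 1"] by blast
    obtain c' :: nat where c': "\<And>n m h d L. h = n - n div 2 \<Longrightarrow> d = K * (m + n + 1) \<Longrightarrow>
        L = zone d * (2 * 2 ^ h + 1) \<Longrightarrow>
        real (L * (24 * m + (80 * q + 600)) + T L) \<le> real (c' * (m + 1) ^ 7) * 2 powr ((1 - e / 4) * real n)"
      using reduction_time_bound[OF e(1,2) c K(2), of "80 * q + 600"] by blast
    define f where "f m = c' * (m + 1) ^ 7" for m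
    have "(\<lambda>m. real (f m)) \<in> O(\<lambda>m. real m ^ 7)"
      unfolding f_def of_nat_mult of_nat_power of_nat_add by real_asymp
    moreover have "solves_in_time (sat_prog b K p) enc_cnf (q_cnf q) sat_spec
       (\<lambda>(n, F). real (f (length F)) * 2 powr ((1 - e / 4) * real n))"
      unfolding solves_in_time_def
    \<comment> \<open>The constant \<open>a\<close> may be 0. One more logarithm guarantees that
      words can hold \<open>X\<close>, and with it all values that the reduction computes.\<close>
    proof (rule exI[of _ "a + 1"], intro ballI allI impI, elim conjE)
      fix \<phi> :: cnf and w
      define \<tau> where "\<tau> = (case \<phi> of (n, F) \<Rightarrow> real (f (length F)) * 2 powr ((1 - e / 4) * real n))"
      assume "\<phi> \<in> q_cnf q" and "real (a + 1) * log 2 (real (length (enc_cnf \<phi>)) +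
          (case \<phi> of (n, F) \<Rightarrow> real (f (length F)) * 2 powr ((1 - e / 4) * real n))) \<le> real w"
      then obtain n F where \<phi>: "\<phi> = (n, F)" and F: "(n, F) \<in> q_cnf q"
        and w: "real (a + 1) * log 2 (real (length (enc_cnf (n, F))) + \<tau>) \<le> real w"
        unfolding \<tau>_def by (cases \<phi>) auto
      define h where "h = n - n div 2"
      define d where "d = K * (length F + n + 1)"
      define L where "L = zone d * (2 * 2 ^ h + 1)"
      \<comment> \<open>\<open>X\<close> majorizes everything at once: the total time, where 600 in
        place of 500 pays for the last step, the size plus time of the LCS instance, and
        \<open>8 * L + 8\<close>. So \<open>X \<le> \<tau>\<close> yields both the time bound and
        the word length.\<close>
      define X where "X = L * (24 * length F + (80 * q + 600)) + T L"
      have X: "real X \<le> \<tau>"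
        unfolding X_def \<tau>_def f_def \<phi> prod.case by (rule c'[OF h_def d_def L_def])
      have "0 < d" using K by (simp add: d_def)
      then have L1: "1 \<le> L" by (simp add: L_def zone_def Suc_le_eq)
      have "L * 600 \<le> L * (24 * length F + (80 * q + 600))" by (intro mult_left_mono) auto
      then have XL: "600 * L + T L \<le> X" by (simp add: X_def)
      have dL: "d \<le> L"
      proof -
        have "d \<le> zone d" using zone_ge[of d] by simp
        also have "\<dots> \<le> L" by (simp add: L_def)
        finally show ?thesis .
      qed
      have lX: "0 \<le> log 2 (real X)" using XL L1 by simp
      have "log 2 (real X) \<le> log 2 (real (length (enc_cnf (n, F))) + \<tau>)"
        using X XL L1 by (intro log_mono) auto
      then have "real (a + 1) * log 2 (real X) \<le> real (a + 1) * log 2 (real (length (enc_cnf (n, F))) + \<tau>)"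
        by (intro mult_left_mono) auto
      then have wX: "real (a + 1) * log 2 (real X) \<le> real w" using w by linarith
      have "log 2 (real X) \<le> real w" using wX lX mult_right_mono[of 1 "real (a + 1)" "log 2 (real X)"] by simp
      then have "real X \<le> 2 powr real w" using XL L1 by (subst (asm) log_le_iff) auto
      then have "real X \<le> real (2 ^ w)" by (simp add: powr_realpow)
      then have X2: "X \<le> 2 ^ w" by (simp only: of_nat_le_iff)
      then have w8: "8 * L + 8 < 2 ^ w" using XL L1 by linarith
      define x where "x = (gadget_text (2 ^ h) d (half_unsat h F) 0, gadget_text (2 ^ h) d (half_unsat h F) 1, d)"
      have lenx: "length (fst x) = L" by (simp add: x_def length_gadget_text L_def)
      have lenc: "length (enc_lcs x) = 2 + 2 * L"
        unfolding x_def by (rule enc_lcs_gadget(1)[OF L_def])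
      have "C * log 2 (real L) \<le> real d"
        by (rule pad[of "length F + n + 1" h, OF _ _ d_def L_def]) (auto simp: h_def)
      then have "x \<in> lcs_instances C"
        by (simp add: lcs_instances_def x_def length_gadget_text L_def)
      moreover have "\<forall>v\<in>set (enc_lcs x). v < 2 ^ w"
      proof
        fix v assume "v \<in> set (enc_lcs x)"
        then have "v \<in> {L, d, 0, 1}" using enc_lcs_gadget(2)[OF L_def] unfolding x_def by blast
        then show "v < 2 ^ w" using dL w8 by auto
      qed
      moreover have "real a * log 2 (real (length (enc_lcs x)) + real (T (length (fst x)))) \<le> real w"
      proof -
        have "real (length (enc_lcs x)) + real (T (length (fst x))) \<le> real X"
          using XL L1 by (simp add: lenc lenx)
        then have "log 2 (real (length (enc_lcs x)) + real (T (length (fst x)))) \<le> log 2 (real X)"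
          by (intro log_mono) (auto simp: lenc)
        then have "real a * log 2 (real (length (enc_lcs x)) + real (T (length (fst x)))) \<le> real a * log 2 (real X)"
          by (intro mult_left_mono) auto
        also have "\<dots> \<le> real w" using wX lX by (simp add: algebra_simps)
        finally show ?thesis .
      qed
      ultimately obtain tp R M where R: "exec w p (init (enc_lcs x)) tp (R, M)"
          "real tp \<le> real (T L)" "lcs_spec x R"
        using a[of x w] unfolding lenx by blast
      from exec_sat_prog[OF F K(1) h_def d_def L_def w8 b x_def R(1,3)] obtain t R' M' where
        *: "exec w (sat_prog b K p) (init (enc_cnf (n, F))) t (R', M')"
          "t \<le> L * (24 * length F + 80 * q + 500) + tp + 1" "sat_spec (n, F) R'"
        by blast
      have "t \<le> X" using *(2) R(2) L1 by (simp add: X_def algebra_simps)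
      then have "real t \<le> \<tau>" using X by linarith
      with * show "\<exists>t R M. exec w (sat_prog b K p) (init (enc_cnf \<phi>)) t (R, M) \<and>
          real t \<le> (case \<phi> of (n, F) \<Rightarrow> real (f (length F)) * 2 powr ((1 - e / 4) * real n)) \<and> sat_spec \<phi> R"
        unfolding \<tau>_def[symmetric] unfolding \<phi> by blast
    qed
    ultimately show ?thesis by blast
  qed
  moreover have "e / 4 > 0" using e(1) by simp
  ultimately show ?thesis unfolding SETH_def by blast
qed

end
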